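(* Let $p$ be an odd prime and $D_{2p}=\langle \tau,\sigma\mid \tau^p=\sigma^2=e,\ \sigma\tau\sigma=\tau^{-1}\rangle$ the dihedral group of order $2p$. The number of Cayley digraphs on $D_{2p}$ up to isomorphism (i.e. the number of isomorphism classes of digraphs $\mathrm{Cay}(D_{2p},S)$ with $S\subseteq D_{2p}\setminus\{e\}$) is $$\mathcal{N}=\frac{1}{p}2^{p}(1-2^{p-1})+\frac{2}{p-1}\sum_{d\mid(p-1)}\Phi(d)\,2^{\frac{2(p-1)}{d}},$$ where $\Phi$ is Euler's totient function.
   Context: For a finite group $G$ and $S\subseteq G$ with $e\notin S$, the Cayley digraph $\mathrm{Cay}(G,S)$ has vertex set $G$ and an arc from $g$ to $h$ whenever $hg^{-1}\in S$. *)

theory Defs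
  imports
    "HOL-Algebra.Generated_Groups"
    "HOL-Number_Theory.Totient"
    "Graph_Theory.Digraph_Isomorphism"
begin

text \<open>
  A group generated by \<open>\<tau>\<close> and \<open>\<sigma>\<close> subject to the relations below is a quotient of the group
  presented by them; since the latter has order \<open>2n\<close> (for \<open>n > 0\<close>), the last assumption says
  that no further relations hold, which pins the group down up to isomorphism.
\<close>

locale dihedral_group = group G for G (structure) +
  fixes n :: nat and \<tau> \<sigma>
  assumes tau_closed: "\<tau> \<in> carrier G"
    and sigma_closed: "\<sigma> \<in> carrier G"
    and generated: "generate G {\<tau>, \<sigma>} = carrier G"
    and tau_pow: "\<tau> [^] n = \<one>"
    and sigma_pow: "\<sigma> [^] (2::nat) = \<one>"
    and sigma_tau_sigma: "\<sigma> \<otimes> \<tau> \<otimes> \<sigma> = inv \<tau>"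
    and order_eq: "order G = 2 * n"

text \<open>Arcs are the ordered pairs of vertices, so there are no parallel arcs.\<close>

definition Cay :: "('a, 'm) monoid_scheme \<Rightarrow> 'a set \<Rightarrow> ('a, 'a \<times> 'a) pre_digraph" where
  "Cay G S = \<lparr>verts = carrier G,
     arcs = {(g, h). g \<in> carrier G \<and> h \<in> carrier G \<and> h \<otimes>\<^bsub>G\<^esub> inv\<^bsub>G\<^esub> g \<in> S},
     tail = fst, head = snd\<rparr>"

definition cayley_digraphs :: "('a, 'm) monoid_scheme \<Rightarrow> ('a, 'a \<times> 'a) pre_digraph set" where
  "cayley_digraphs G = {Cay G S | S. S \<subseteq> carrier G - {\<one>\<^bsub>G\<^esub>}}"

definition iso_classes :: "('a, 'b) pre_digraph set \<Rightarrow> ('a, 'b) pre_digraph set set" where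
  "iso_classes \<C> = \<C> // {(X, Y). X \<in> \<C> \<and> Y \<in> \<C> \<and> digraph_iso X Y}"

text \<open>
  Sanity checks: Cayley digraphs with \<open>e \<notin> S\<close> are loop-free digraphs without parallel arcs,
  isomorphism is an equivalence relation on them, and the dihedral locale has a model for
  every \<open>n > 0\<close>.
\<close>

lemma wf_digraph_Cay: "wf_digraph (Cay G S)"
  by unfold_locales (auto simp: Cay_def)

lemma (in group) loopfree_digraph_Cay: "\<one> \<notin> S \<Longrightarrow> loopfree_digraph (Cay G S)"
  by unfold_locales (auto simp: Cay_def)

lemma nomulti_digraph_Cay: "nomulti_digraph (Cay G S)"
  by unfold_locales (auto simp: Cay_def arc_to_ends_def)

lemma digraph_iso_refl:
  assumes "wf_digraph H"
  shows "digraph_iso H H"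
  unfolding digraph_iso_def
  by (rule exI[of _ "\<lparr>iso_verts = id, iso_arcs = id, iso_head = head H, iso_tail = tail H\<rparr>"])
     (use assms in \<open>auto simp: pre_digraph.digraph_isomorphism_def app_iso_def\<close>)

lemma equiv_digraph_iso_Cay:
  "equiv (cayley_digraphs G)
     {(X, Y). X \<in> cayley_digraphs G \<and> Y \<in> cayley_digraphs G \<and> digraph_iso X Y}"
proof (rule equivI)
  have wf: "wf_digraph X" if "X \<in> cayley_digraphs G" for X
    using that by (auto simp: cayley_digraphs_def wf_digraph_Cay)
  show "{(X, Y). X \<in> cayley_digraphs G \<and> Y \<in> cayley_digraphs G \<and> digraph_iso X Y}
        \<subseteq> cayley_digraphs G \<times> cayley_digraphs G"
    by auto
  show "refl_on (cayley_digraphs G)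
     {(X, Y). X \<in> cayley_digraphs G \<and> Y \<in> cayley_digraphs G \<and> digraph_iso X Y}"
    by (auto simp: refl_on_def wf digraph_iso_refl)
  show "sym {(X, Y). X \<in> cayley_digraphs G \<and> Y \<in> cayley_digraphs G \<and> digraph_iso X Y}"
    by (auto simp: sym_def intro: digraph_iso_swap[OF wf])
  show "trans {(X, Y). X \<in> cayley_digraphs G \<and> Y \<in> cayley_digraphs G \<and> digraph_iso X Y}"
    by (auto simp: trans_def intro: digraph_iso_trans)
qed

definition dihedral_model :: "nat \<Rightarrow> (int \<times> bool) monoid" where
  "dihedral_model n = \<lparr>carrier = {0..<int n} \<times> UNIV,
     monoid.mult = (\<lambda>(i, s) (j, t). ((if s then i - j else i + j) mod int n, s \<noteq> t)),
     one = (0, False)\<rparr>"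

lemma group_dihedral_model:
  assumes "n > 0"
  shows "group (dihedral_model n)"
proof (rule groupI)
  fix x assume x: "x \<in> carrier (dihedral_model n)"
  obtain i s where [simp]: "x = (i, s)" by (cases x)
  show "\<exists>y\<in>carrier (dihedral_model n). y \<otimes>\<^bsub>dihedral_model n\<^esub> x = \<one>\<^bsub>dihedral_model n\<^esub>"
    using x assms
    by (intro bexI[of _ "((if s then i else - i) mod int n, s)"])
       (auto simp: dihedral_model_def mod_simps)
qed (use assms in \<open>auto simp: dihedral_model_def mod_simps algebra_simps\<close>)

lemma dihedral_group_model:
  assumes "n > 0"
  shows "dihedral_group (dihedral_model n) n (1 mod int n, False) (0, True)"
proof -
  let ?G = "dihedral_model n" and ?t = "(1 mod int n, False)" and ?s = "(0::int, True)"
  interpret group ?G using assms by (rule group_dihedral_model)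
  have t: "?t \<in> carrier ?G" and s: "?s \<in> carrier ?G"
    using assms by (auto simp: dihedral_model_def)
  have tpow: "?t [^]\<^bsub>?G\<^esub> k = (int k mod int n, False)" for k :: nat
    by (induction k) (simp_all add: dihedral_model_def mod_simps algebra_simps)
  have ts: "?t [^]\<^bsub>?G\<^esub> k \<otimes>\<^bsub>?G\<^esub> ?s = (int k mod int n, True)" for k :: nat
    unfolding tpow by (simp add: dihedral_model_def)
  have gen: "x \<in> generate ?G {?t, ?s}" if x: "x \<in> carrier ?G" for x
  proof -
    obtain i b where [simp]: "x = (i, b)" by (cases x)
    have "?t [^]\<^bsub>?G\<^esub> k \<in> generate ?G {?t, ?s}" for k :: nat
      by (induction k) (auto intro: generate.intros)
    then have "?t [^]\<^bsub>?G\<^esub> nat i \<in> generate ?G {?t, ?s}"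
      "?t [^]\<^bsub>?G\<^esub> nat i \<otimes>\<^bsub>?G\<^esub> ?s \<in> generate ?G {?t, ?s}"
      by (auto intro: generate.intros)
    then have "(int (nat i) mod int n, False) \<in> generate ?G {?t, ?s}"
      "(int (nat i) mod int n, True) \<in> generate ?G {?t, ?s}"
      by (simp_all only: ts) (simp only: tpow)
    moreover have "0 \<le> i" "i < int n" using x by (auto simp: dihedral_model_def)
    ultimately show ?thesis by (cases b) auto
  qed
  show ?thesis
  proof unfold_locales
    show "generate ?G {?t, ?s} = carrier ?G"
      using gen generate_incl[of "{?t, ?s}"] t s by blast
    show "?t [^]\<^bsub>?G\<^esub> n = \<one>\<^bsub>?G\<^esub>"
      unfolding tpow by (simp add: dihedral_model_def)
    show "?s [^]\<^bsub>?G\<^esub> (2::nat) = \<one>\<^bsub>?G\<^esub>"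
      by (simp add: numeral_2_eq_2 dihedral_model_def)
    show "?s \<otimes>\<^bsub>?G\<^esub> ?t \<otimes>\<^bsub>?G\<^esub> ?s = inv\<^bsub>?G\<^esub> ?t"
      by (rule inv_equality[symmetric])
         (use assms in \<open>auto simp: dihedral_model_def mod_simps\<close>)
    show "order ?G = 2 * n"
      by (simp add: order_def dihedral_model_def card_cartesian_product)
  qed (use t s in auto)
qed

end

theory Submission
  imports
    Defs
    "HOL-Number_Theory.Residue_Primitive_Roots"
    "HOL-Combinatorics.Permutations"
begin

text \<open>
  Write \<open>t\<close> for right translation by \<open>\<tau>\<close>, an automorphism of every Cayley digraph. The group
  \<open>\<langle>t\<rangle> \<times> \<langle>t\<rangle>\<close> acts on the set of isomorphisms from \<open>Cay(S)\<close> to \<open>Cay(T)\<close> by \<open>f \<mapsto> t\<^sup>a f t\<^sup>b\<close>,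
  and every \<open>f\<close> that does not normalise \<open>\<langle>t\<rangle>\<close> has an orbit of size \<open>p\<^sup>2\<close>. An isomorphism that
  normalises \<open>\<langle>t\<rangle>\<close> is, up to a translation, an automorphism of the dihedral group, i.e.
  \<open>\<tau>\<^sup>i \<mapsto> \<tau>\<^bsup>ui\<^esup>\<close>, \<open>\<sigma>\<tau>\<^sup>i \<mapsto> \<sigma>\<tau>\<^bsup>ui+b\<^esup>\<close>.
  If there is none, \<open>p\<^sup>2\<close> divides the order of both automorphism groups. The same action then shows
  that at least \<open>p\<close> automorphisms normalise \<open>\<langle>t\<rangle>\<close> and fix the identity; two of them share \<open>u\<close>, so
  \<open>S\<close> (and likewise \<open>T\<close>) contains all reflections or none, which reduces the question to circulant
  digraphs on \<open>p\<close> vertices. There the orbit argument always succeeds, because \<open>p\<^sup>2\<close> does not divide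
  \<open>p!\<close>. Hence isomorphic Cayley digraphs have connection sets in the same orbit of the automorphism
  group of the dihedral group, and Burnside's lemma counts these orbits.
\<close>

section \<open>Permutation groups and invariant sets\<close>

lemma bij_comp_left_cancel: "bij g \<Longrightarrow> g \<circ> f = g \<circ> h \<longleftrightarrow> f = h"
  by (auto simp: fun_eq_iff dest: bij_is_inj injD)

lemma bij_comp_right_cancel: "bij g \<Longrightarrow> f \<circ> g = h \<circ> g \<longleftrightarrow> f = h"
  by (auto simp: fun_eq_iff) (metis bij_pointE)

lemma intertwine_funpow:
  assumes "f \<circ> s = r \<circ> f"
  shows "f \<circ> (s ^^ k) = (r ^^ k) \<circ> f"
proof (induction k)
  case (Suc k)
  have "f \<circ> s ^^ Suc k = (f \<circ> s) \<circ> s ^^ k"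
    by (simp add: comp_assoc)
  also have "\<dots> = r \<circ> (f \<circ> s ^^ k)"
    by (simp add: assms comp_assoc)
  finally show ?case
    by (simp only: Suc funpow.simps comp_assoc)
qed simp

lemma funpow_mod_period:
  assumes "t ^^ p = id"
  shows "t ^^ (k mod p) = t ^^ k"
proof -
  have "t ^^ k = t ^^ (p * (k div p) + k mod p)"
    by simp
  also have "\<dots> = (t ^^ p) ^^ (k div p) \<circ> t ^^ (k mod p)"
    by (simp only: funpow_add funpow_mult mult.commute)
  finally show ?thesis
    by (simp add: assms)
qed

text \<open>The maps \<open>t^a f t^b\<close> with \<open>a, b < p\<close> are pairwise distinct, so
  \<open>X\<close> splits into orbits of size \<open>p^2\<close>. A coincidence gives
  \<open>f t^d = t^c f\<close>; if \<open>p\<close> did not divide \<open>d\<close>, raising to an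
  inverse of \<open>d\<close> modulo \<open>p\<close> would give \<open>f t = t^k f\<close> for some
  \<open>k\<close>, which is excluded. Hence \<open>t^d = id\<close>, and then
  \<open>t^c = id\<close>.\<close>

lemma prime_square_dvd_card_two_sided:
  fixes t :: "'a \<Rightarrow> 'a"
  assumes p: "prime p" and X: "finite X"
    and t: "bij t" "t ^^ p = id" "t \<noteq> id"
    and bij: "\<And>f. f \<in> X \<Longrightarrow> bij f"
    and left: "\<And>f. f \<in> X \<Longrightarrow> t \<circ> f \<in> X" and right: "\<And>f. f \<in> X \<Longrightarrow> f \<circ> t \<in> X"
    and no_norm: "\<And>f c. f \<in> X \<Longrightarrow> f \<circ> t \<noteq> t ^^ c \<circ> f"
  shows "p ^ 2 dvd card X"
proof -
  define \<phi> where "\<phi> f = (\<lambda>(a, b). (t ^^ a) \<circ> f \<circ> (t ^^ b))" for f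
  define r where "r = {(f, g). f \<in> X \<and> (\<exists>ab. g = \<phi> f ab)}"
  have p0: "p > 0" using p prime_gt_0_nat by blast
  have X_left: "t ^^ a \<circ> f \<in> X" if "f \<in> X" for a f
    using that by (induction a) (auto simp: comp_assoc left)
  have X_right: "f \<circ> t ^^ a \<in> X" if "f \<in> X" for a f
  proof (induction a)
    case (Suc a)
    then show ?case using right[OF Suc] by (simp only: funpow_Suc_right comp_assoc)
  qed (use that in simp)
  have \<phi>X: "\<phi> f ab \<in> X" if "f \<in> X" for f ab
    using that by (auto simp: \<phi>_def split: prod.split intro: X_left X_right)
  have \<phi>\<phi>: "\<phi> (\<phi> f (a, b)) (c, d) = \<phi> f (c + a, b + d)" for f a b c d
    by (simp add: \<phi>_def funpow_add comp_assoc)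
  have \<phi>mod: "\<phi> f (a, b) = \<phi> f (a mod p, b mod p)" for f a b
    by (simp add: \<phi>_def funpow_mod_period[OF t(2)])
  have \<phi>0: "\<phi> f (0, 0) = f" for f
    by (simp add: \<phi>_def)
  have eq: "equiv X r"
  proof (rule equivI)
    show "r \<subseteq> X \<times> X" using \<phi>X by (auto simp: r_def)
    show "refl_on X r" unfolding refl_on_def r_def using \<phi>0 by (metis (mono_tags, lifting) CollectI case_prodI)
    show "sym r"
    proof (rule symI)
      fix f g assume "(f, g) \<in> r"
      then obtain a b where f: "f \<in> X" and g: "g = \<phi> f (a, b)" by (auto simp: r_def)
      \<comment> \<open>Exponents are natural numbers, so the inverse of \<open>t^a\<close> is
        written \<open>t^(a * (p - 1))\<close>.\<close>
      have "\<phi> g (a * (p - 1), b * (p - 1)) = \<phi> f (a * p, b * p)"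
        using p0 by (cases p) (simp_all add: g \<phi>\<phi> algebra_simps)
      also have "\<dots> = f" by (subst \<phi>mod) (simp add: \<phi>0)
      finally have "f = \<phi> g (a * (p - 1), b * (p - 1))" ..
      moreover have "g \<in> X" using f \<phi>X by (simp add: g)
      ultimately show "(g, f) \<in> r" unfolding r_def by blast
    qed
    show "trans r"
      by (rule transI) (auto simp: r_def \<phi>\<phi>, blast)
  qed
  have "card C = p ^ 2" if "C \<in> X // r" for C
  proof -
    from that obtain f where f: "f \<in> X" and C: "C = r `` {f}" by (auto elim: quotientE)
    have "C = \<phi> f ` ({..<p} \<times> {..<p})"
    proof
      show "C \<subseteq> \<phi> f ` ({..<p} \<times> {..<p})"
      proof
        fix g assume "g \<in> C"
        then obtain a b where "g = \<phi> f (a, b)" by (auto simp: C r_def)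
        then have "g = \<phi> f (a mod p, b mod p)" using \<phi>mod by metis
        then show "g \<in> \<phi> f ` ({..<p} \<times> {..<p})" using p0 by auto
      qed
    qed (use f in \<open>auto simp: C r_def\<close>)
    moreover have "inj_on (\<phi> f) ({..<p} \<times> {..<p})"
    proof (rule inj_onI, clarsimp)
      fix a b a' b' assume lt: "a < p" "b < p" "a' < p" "b' < p"
        and e: "\<phi> f (a, b) = \<phi> f (a', b')"
      \<comment> \<open>Composing with \<open>t^(p - a')\<close> on the left and
        \<open>t^(p - b)\<close> on the right separates the two sides; \<open>c\<close> and
        \<open>d\<close> represent \<open>a - a'\<close> and \<open>b' - b\<close> modulo
        \<open>p\<close>.\<close>
      define c where "c = (p - a') + a"
      define d where "d = b' + (p - b)"
      have "\<phi> (\<phi> f (a, b)) (p - a', p - b) = \<phi> (\<phi> f (a', b')) (p - a', p - b)"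
        by (simp add: e)
      then have "\<phi> f (c, p) = \<phi> f (p, d)"
        using lt by (simp add: \<phi>\<phi> c_def d_def)
      then have cd: "f \<circ> t ^^ d = t ^^ c \<circ> f"
        by (simp add: \<phi>_def t)
      have inverse: "\<exists>e. [k * e = 1] (mod p)" if "\<not> p dvd k" for k :: nat
        using cong_solve_coprime_nat[of k p] prime_imp_coprime[OF p that] by (simp add: coprime_commute)
      have "p dvd d"
      proof (rule ccontr)
        assume "\<not> p dvd d"
        then obtain e where e: "[d * e = 1] (mod p)" using inverse by blast
        then have "t ^^ (d * e) = t"
          using funpow_mod_period[OF t(2), of "d * e"] funpow_mod_period[OF t(2), of 1]
          by (simp add: cong_def)
        then have "f \<circ> t = f \<circ> (t ^^ d) ^^ e" by (simp add: funpow_mult mult.commute)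
        also have "\<dots> = (t ^^ c) ^^ e \<circ> f" using intertwine_funpow[OF cd] .
        also have "\<dots> = t ^^ (c * e) \<circ> f" by (simp add: funpow_mult mult.commute)
        finally show False using no_norm[OF f] by blast
      qed
      have "t ^^ d = id"
        using \<open>p dvd d\<close> funpow_mod_period[OF t(2), of d] by auto
      then have "t ^^ c = id"
        using cd bij_comp_right_cancel[OF bij[OF f], of "t ^^ c" id] by simp
      have "p dvd c"
      proof (rule ccontr)
        assume "\<not> p dvd c"
        then obtain e where e: "[c * e = 1] (mod p)" using inverse by blast
        then have "t ^^ (c * e) = t"
          using funpow_mod_period[OF t(2), of "c * e"] funpow_mod_period[OF t(2), of 1]
          by (simp add: cong_def)
        moreover have "t ^^ (c * e) = id"
          using \<open>t ^^ c = id\<close> by (metis funpow_mult mult.commute id_funpow)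
        ultimately show False using t(3) by simp
      qed
      \<comment> \<open>The sum \<open>b' + (p - b)\<close> lies strictly between \<open>0\<close>
        and \<open>2 * p\<close>, so as a multiple of \<open>p\<close> it equals
        \<open>p\<close>.\<close>
      have "b = b'" if "p dvd b' + (p - b)" "b < p" "b' < p" for b b'
      proof -
        obtain k where k: "b' + (p - b) = p * k" using \<open>p dvd b' + (p - b)\<close> by auto
        have "0 < p * k" "p * k < p * 2" using that k by linarith+
        then have "k = 1" using p0 by simp
        then show ?thesis using k that by simp
      qed
      then show "a = a' \<and> b = b'"
        using \<open>p dvd d\<close> \<open>p dvd c\<close> lt by (auto simp: c_def d_def add.commute)
    qed
    ultimately show ?thesis
      by (simp add: card_image card_cartesian_product power2_eq_square)
  qed
  then show ?thesis
    using equiv_imp_dvd_card[OF X eq, of "p ^ 2"] by simp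
qed

section \<open>Lagrange, Burnside and unions of equivalence classes\<close>

text \<open>Lagrange's theorem in the symmetric group, for a group given as a plain set of
  functions. It limits which prime powers can divide the order of an automorphism group.\<close>

lemma card_perm_group_dvd_fact:
  assumes A: "finite A" and K: "K \<subseteq> {f. f permutes A}" "id \<in> K"
    and comp: "\<And>f g. f \<in> K \<Longrightarrow> g \<in> K \<Longrightarrow> f \<circ> g \<in> K"
    and inv: "\<And>f. f \<in> K \<Longrightarrow> Hilbert_Choice.inv f \<in> K"
  shows "card K dvd fact (card A)"
proof -
  define S :: "('a \<Rightarrow> 'a) monoid" where "S = \<lparr>carrier = {f. f permutes A}, monoid.mult = (\<circ>), one = id\<rparr>"
  have S: "group S"
  proof (rule groupI)
    fix f assume "f \<in> carrier S"
    then show "\<exists>g\<in>carrier S. g \<otimes>\<^bsub>S\<^esub> f = \<one>\<^bsub>S\<^esub>"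
      by (intro bexI[of _ "Hilbert_Choice.inv f"])
        (auto simp: S_def permutes_inv permutes_inv_o)
  qed (auto simp: S_def permutes_compose permutes_id comp_assoc)
  interpret group S by (rule S)
  have inv_eq: "inv\<^bsub>S\<^esub> f = Hilbert_Choice.inv f" if "f permutes A" for f
    using that by (intro inv_equality) (auto simp: S_def permutes_inv permutes_inv_o)
  have "subgroup K S"
    by (rule subgroupI) (use K comp inv inv_eq in \<open>auto simp: S_def\<close>)
  from lagrange[OF this] have "card K dvd order S" by (metis dvd_triv_right)
  also have "order S = fact (card A)"
    using card_permutations[OF refl A] by (simp add: order_def S_def)
  finally show ?thesis .
qed

text \<open>Burnside's lemma, by counting in two ways the pairs \<open>(h, S)\<close> in which
  \<open>h\<close> maps \<open>S\<close> onto itself: over each orbit the stabiliser orders add up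
  to \<open>card H\<close>.\<close>

lemma burnside_sets:
  assumes H: "finite H" "id \<in> H" "\<And>h. h \<in> H \<Longrightarrow> bij h"
    and comp: "\<And>f g. f \<in> H \<Longrightarrow> g \<in> H \<Longrightarrow> f \<circ> g \<in> H"
    and inv: "\<And>f. f \<in> H \<Longrightarrow> Hilbert_Choice.inv f \<in> H"
    and \<Omega>: "finite \<Omega>" "\<And>h S. h \<in> H \<Longrightarrow> S \<in> \<Omega> \<Longrightarrow> h ` S \<in> \<Omega>"
  shows "(\<Sum>h\<in>H. card {S \<in> \<Omega>. h ` S = S})
    = card H * card (\<Omega> // {(S, T). S \<in> \<Omega> \<and> T \<in> \<Omega> \<and> (\<exists>h\<in>H. h ` S = T)})"
proof -
  define r where "r = {(S, T). S \<in> \<Omega> \<and> T \<in> \<Omega> \<and> (\<exists>h\<in>H. h ` S = T)}"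
  define stab where "stab S = {h \<in> H. h ` S = S}" for S :: "'a set"
  have eq: "equiv \<Omega> r"
  proof (rule equivI)
    show "r \<subseteq> \<Omega> \<times> \<Omega>" by (auto simp: r_def)
    show "refl_on \<Omega> r" using H(2) by (auto simp: r_def refl_on_def intro!: bexI[of _ id])
    show "sym r"
    proof (rule symI)
      fix S T assume "(S, T) \<in> r"
      then obtain h where h: "S \<in> \<Omega>" "T \<in> \<Omega>" "h \<in> H" "h ` S = T" by (auto simp: r_def)
      then have "Hilbert_Choice.inv h ` T = S"
        using H(3) by (metis bij_is_inj image_inv_f_f)
      then show "(T, S) \<in> r" using h inv by (auto simp: r_def)
    qed
    show "trans r"
    proof (rule transI)
      fix S T U assume "(S, T) \<in> r" "(T, U) \<in> r"
      then obtain h g where h: "S \<in> \<Omega>" "U \<in> \<Omega>" "h \<in> H" "g \<in> H" "h ` S = T" "g ` T = U"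
        by (auto simp: r_def)
      then show "(S, U) \<in> r"
        using comp[of g h] by (auto simp: r_def image_comp intro!: bexI[of _ "g \<circ> h"])
    qed
  qed
  \<comment> \<open>Orbit-stabiliser in summed form: the sets of those \<open>h\<close> that send
    \<open>S\<close> to a given \<open>T\<close> partition \<open>H\<close>, and each is a coset of
    \<open>stab T\<close>.\<close>
  have class_sum: "(\<Sum>S\<in>C. card (stab S)) = card H" if "C \<in> \<Omega> // r" for C
  proof -
    from that obtain S where S: "S \<in> \<Omega>" and C: "C = r `` {S}" by (auto elim: quotientE)
    have C': "C = (\<lambda>h. h ` S) ` H" using S \<Omega>(2) by (auto simp: C r_def)
    have fibre: "card {h \<in> H. h ` S = T} = card (stab T)" if "T \<in> C" for T
    proof -
      from that obtain k where k: "k \<in> H" "T = k ` S" by (auto simp: C')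
      have bk: "bij k" using H(3) k by blast
      have "bij_betw (\<lambda>h. h \<circ> k) (stab T) {h \<in> H. h ` S = T}"
      proof (rule bij_betw_byWitness[where f' = "\<lambda>h. h \<circ> Hilbert_Choice.inv k"])
        show "\<forall>h\<in>stab T. (h \<circ> k) \<circ> Hilbert_Choice.inv k = h"
          using bk by (simp add: fun_eq_iff bij_inv_eq_iff surj_f_inv_f bij_is_surj)
        show "\<forall>h\<in>{h \<in> H. h ` S = T}. (h \<circ> Hilbert_Choice.inv k) \<circ> k = h"
          using bk by (simp add: fun_eq_iff inv_f_f bij_is_inj)
        show "(\<lambda>h. h \<circ> k) ` stab T \<subseteq> {h \<in> H. h ` S = T}"
          using k comp by (clarsimp simp: stab_def) (metis image_image)
        have "Hilbert_Choice.inv k ` T = S"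
          using bk k by (metis bij_is_inj image_inv_f_f)
        then show "(\<lambda>h. h \<circ> Hilbert_Choice.inv k) ` {h \<in> H. h ` S = T} \<subseteq> stab T"
          using k comp inv by (clarsimp simp: stab_def) (metis image_image)
      qed
      then show ?thesis by (simp add: bij_betw_same_card)
    qed
    have "card H = card (\<Union>T\<in>C. {h \<in> H. h ` S = T})"
      by (rule arg_cong[where f = card]) (auto simp: C')
    also have "\<dots> = (\<Sum>T\<in>C. card {h \<in> H. h ` S = T})"
      by (rule card_UN_disjoint) (auto simp: C' H)
    finally show ?thesis by (simp add: fibre)
  qed
  have "(\<Sum>h\<in>H. card {S \<in> \<Omega>. h ` S = S}) = (\<Sum>h\<in>H. \<Sum>S\<in>\<Omega>. if h ` S = S then 1 else 0)"
    by (simp only: card_eq_sum sum.inter_filter[OF \<Omega>(1)])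
  also have "\<dots> = (\<Sum>S\<in>\<Omega>. card (stab S))"
    by (subst sum.swap) (simp only: stab_def card_eq_sum sum.inter_filter[OF H(1)])
  also have "\<dots> = (\<Sum>S\<in>\<Union>(\<Omega> // r). card (stab S))"
    by (simp add: Union_quotient[OF eq])
  also have "\<dots> = (\<Sum>C\<in>\<Omega> // r. \<Sum>S\<in>C. card (stab S))"
    using quotient_disj[OF eq] finite_equiv_class[OF \<Omega>(1)] eq
    by (subst sum.Union_disjoint) (auto simp: equiv_def)
  also have "\<dots> = card H * card (\<Omega> // r)"
    by (simp add: class_sum)
  finally show ?thesis by (simp add: r_def)
qed

text \<open>A subset closed under \<open>r\<close> is a union of classes, and any set of classes may
  be chosen.\<close>

lemma card_saturated_subsets:
  assumes A: "finite A" and r: "equiv A r"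
  shows "card {S. S \<subseteq> A \<and> r `` S \<subseteq> S} = 2 ^ card (A // r)"
proof -
  have "bij_betw Union (Pow (A // r)) {S. S \<subseteq> A \<and> r `` S \<subseteq> S}"
  proof (rule bij_betw_byWitness[where f' = "\<lambda>S. {C \<in> A // r. C \<subseteq> S}"])
    have "C \<in> Q" if Q: "Q \<subseteq> A // r" and C: "C \<in> A // r" "C \<subseteq> \<Union>Q" for Q C
    proof -
      obtain x where x: "x \<in> C" using in_quotient_imp_non_empty[OF r C(1)] by blast
      then obtain D where D: "D \<in> Q" "x \<in> D" using C by blast
      then have "C = D" using quotient_disj[OF r C(1), of D] Q x by blast
      then show ?thesis using D by simp
    qed
    then show "\<forall>Q\<in>Pow (A // r). {C \<in> A // r. C \<subseteq> \<Union>Q} = Q" by auto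
    show "\<forall>S\<in>{S. S \<subseteq> A \<and> r `` S \<subseteq> S}. \<Union>{C \<in> A // r. C \<subseteq> S} = S"
    proof clarify
      fix S assume S: "S \<subseteq> A" "r `` S \<subseteq> S"
      have "x \<in> \<Union>{C \<in> A // r. C \<subseteq> S}" if "x \<in> S" for x
        using that S equiv_class_self[OF r, of x]
        by (auto intro!: exI[of _ "r `` {x}"] quotientI)
      then show "\<Union>{C \<in> A // r. C \<subseteq> S} = S" by blast
    qed
    show "\<Union> ` Pow (A // r) \<subseteq> {S. S \<subseteq> A \<and> r `` S \<subseteq> S}"
    proof clarsimp
      fix Q assume Q: "Q \<subseteq> A // r"
      have "\<Union>Q \<subseteq> A" using Q in_quotient_imp_subset[OF r] by blast
      moreover have "r `` \<Union>Q \<subseteq> \<Union>Q"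
        using Q in_quotient_imp_closed[OF r] by blast
      ultimately show "\<Union>Q \<subseteq> A \<and> r `` \<Union>Q \<subseteq> \<Union>Q" ..
    qed
  qed auto
  then have "card {S. S \<subseteq> A \<and> r `` S \<subseteq> S} = card (Pow (A // r))"
    by (simp add: bij_betw_same_card)
  also have "\<dots> = 2 ^ card (A // r)"
    using finite_quotient[OF A] r by (simp add: card_Pow equiv_def)
  finally show ?thesis .
qed

section \<open>Isomorphisms of binary relations on a finite set\<close>

text \<open>Being the identity outside \<open>A\<close> makes these maps finitely many when
  \<open>A\<close> is finite, and lets composition and inversion be those of total
  functions.\<close>

definition rel_isos :: "'a set \<Rightarrow> ('a \<Rightarrow> 'a \<Rightarrow> bool) \<Rightarrow> ('a \<Rightarrow> 'a \<Rightarrow> bool) \<Rightarrow> ('a \<Rightarrow> 'a) set" where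
  "rel_isos A R R' = {f. f permutes A \<and> (\<forall>x\<in>A. \<forall>y\<in>A. R x y \<longleftrightarrow> R' (f x) (f y))}"

lemma rel_isos_permutes: "f \<in> rel_isos A R R' \<Longrightarrow> f permutes A"
  by (simp add: rel_isos_def)

lemma rel_isos_id: "id \<in> rel_isos A R R"
  by (simp add: rel_isos_def permutes_id)

lemma rel_isos_comp:
  "f \<in> rel_isos A R R' \<Longrightarrow> g \<in> rel_isos A R' R'' \<Longrightarrow> g \<circ> f \<in> rel_isos A R R''"
  by (auto simp: rel_isos_def permutes_compose permutes_in_image)

lemma rel_isos_inv:
  assumes f: "f \<in> rel_isos A R R'"
  shows "Hilbert_Choice.inv f \<in> rel_isos A R' R"
proof -
  have p: "f permutes A" using f by (rule rel_isos_permutes)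
  have "f (Hilbert_Choice.inv f x) = x" for x
    using p by (simp add: permutes_inverses)
  then show ?thesis
    using f permutes_inv[OF p] permutes_in_image[OF permutes_inv[OF p]]
    by (auto simp: rel_isos_def)
qed

lemma finite_rel_isos: "finite A \<Longrightarrow> finite (rel_isos A R R')"
  using finite_permutations by (rule finite_subset[rotated]) (auto simp: rel_isos_def)

text \<open>Left composition with one isomorphism carries the automorphisms of the source onto all
  isomorphisms, so divisibility of the number of isomorphisms passes to the automorphism
  group.\<close>

lemma card_rel_isos_source:
  assumes f: "f \<in> rel_isos A R R'"
  shows "card (rel_isos A R R) = card (rel_isos A R R')"
proof (rule bij_betw_same_card)
  have [simp]: "f \<circ> (Hilbert_Choice.inv f \<circ> g) = g" "Hilbert_Choice.inv f \<circ> (f \<circ> g) = g" for g :: "'a \<Rightarrow> 'a"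
    using rel_isos_permutes[OF f] by (simp_all add: fun_eq_iff permutes_inverses)
  show "bij_betw ((\<circ>) f) (rel_isos A R R) (rel_isos A R R')"
    by (rule bij_betw_byWitness[where f' = "(\<circ>) (Hilbert_Choice.inv f)"])
      (auto intro: rel_isos_comp f rel_isos_inv[OF f])
qed

text \<open>Right composition with \<open>f\<close> does the same for the automorphisms of the
  target.\<close>

lemma card_rel_isos_target:
  assumes f: "f \<in> rel_isos A R R'"
  shows "card (rel_isos A R' R') = card (rel_isos A R R')"
proof (rule bij_betw_same_card)
  have [simp]: "g \<circ> Hilbert_Choice.inv f \<circ> f = g" "g \<circ> f \<circ> Hilbert_Choice.inv f = g" for g :: "'a \<Rightarrow> 'a"
    using rel_isos_permutes[OF f] by (simp_all add: fun_eq_iff permutes_inverses)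
  show "bij_betw (\<lambda>g. g \<circ> f) (rel_isos A R' R') (rel_isos A R R')"
    by (rule bij_betw_byWitness[where f' = "\<lambda>g. g \<circ> Hilbert_Choice.inv f"])
      (auto intro: rel_isos_comp f rel_isos_inv[OF f])
qed

section \<open>Isomorphisms normalising a cyclic group\<close>

text \<open>For a bijection \<open>f\<close> this says that \<open>f t f^-1\<close> is a power of
  \<open>t\<close>. A natural exponent is enough because \<open>t\<close> has finite order wherever
  this is applied.\<close>

definition normalises :: "('a \<Rightarrow> 'a) \<Rightarrow> ('a \<Rightarrow> 'a) \<Rightarrow> bool" where
  "normalises f t \<longleftrightarrow> (\<exists>c. f \<circ> t = t ^^ c \<circ> f)"

lemma normalises_id: "normalises id t"
  by (auto simp: normalises_def intro: exI[of _ 1])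

lemma normalises_comp:
  assumes "normalises f t" "normalises g t"
  shows "normalises (g \<circ> f) t"
proof -
  obtain c d where c: "f \<circ> t = t ^^ c \<circ> f" and d: "g \<circ> t = t ^^ d \<circ> g"
    using assms by (auto simp: normalises_def)
  have "(g \<circ> f) \<circ> t = (g \<circ> t ^^ c) \<circ> f"
    by (simp only: c comp_assoc)
  also have "\<dots> = (t ^^ d) ^^ c \<circ> (g \<circ> f)"
    by (simp only: intertwine_funpow[OF d] comp_assoc)
  finally show ?thesis
    by (auto simp: normalises_def funpow_mult)
qed

text \<open>Composing with \<open>t\<close> on either side cannot create the normalising property,
  so the two-sided action restricts to the non-normalising isomorphisms. Modulo \<open>p^2\<close>
  only the normalising ones count.\<close>

lemma prime_square_dvd_card_non_normalising:
  assumes p: "prime p" and A: "finite A"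
    and t: "t \<in> rel_isos A R R" "t \<in> rel_isos A R' R'" "t ^^ p = id" "t \<noteq> id"
  shows "p ^ 2 dvd card {f \<in> rel_isos A R R'. \<not> normalises f t}"
proof (rule prime_square_dvd_card_two_sided[OF p _ _ t(3,4)])
  have bt: "bij t" using rel_isos_permutes[OF t(1)] by (rule permutes_bij)
  show "bij t" by (fact bt)
  show "finite {f \<in> rel_isos A R R'. \<not> normalises f t}"
    using finite_rel_isos[OF A] by simp
  fix f assume f: "f \<in> {f \<in> rel_isos A R R'. \<not> normalises f t}"
  then show "bij f" using permutes_bij rel_isos_permutes by blast
  show "f \<circ> t \<noteq> t ^^ c \<circ> f" for c
    using f by (auto simp: normalises_def)
  have "\<not> normalises (t \<circ> f) t"
  proof
    assume "normalises (t \<circ> f) t"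
    then obtain c where "t \<circ> f \<circ> t = t ^^ c \<circ> (t \<circ> f)" by (auto simp: normalises_def)
    also have "\<dots> = t \<circ> (t ^^ c \<circ> f)"
      by (simp add: fun_eq_iff funpow_swap1)
    finally have "f \<circ> t = t ^^ c \<circ> f"
      using bij_comp_left_cancel[OF bt, of "f \<circ> t" "t ^^ c \<circ> f"] by (simp only: comp_assoc)
    then show False using f by (auto simp: normalises_def)
  qed
  then show "t \<circ> f \<in> {f \<in> rel_isos A R R'. \<not> normalises f t}"
    using f rel_isos_comp t by blast
  have "\<not> normalises (f \<circ> t) t"
  proof
    assume "normalises (f \<circ> t) t"
    then obtain c where "(f \<circ> t) \<circ> t = (t ^^ c \<circ> f) \<circ> t" by (auto simp: normalises_def comp_assoc)
    then have "f \<circ> t = t ^^ c \<circ> f"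
      using bij_comp_right_cancel[OF bt] by blast
    then show False using f by (auto simp: normalises_def)
  qed
  then show "f \<circ> t \<in> {f \<in> rel_isos A R R'. \<not> normalises f t}"
    using f rel_isos_comp t by blast
qed

lemma card_filter_split:
  assumes "finite A"
  shows "card A = card {x \<in> A. Q x} + card {x \<in> A. \<not> Q x}"
proof -
  have "A = {x \<in> A. Q x} \<union> {x \<in> A. \<not> Q x}" by blast
  then have "card A = card ({x \<in> A. Q x} \<union> {x \<in> A. \<not> Q x})" by simp
  also have "\<dots> = card {x \<in> A. Q x} + card {x \<in> A. \<not> Q x}"
    using assms by (intro card_Un_disjoint) auto
  finally show ?thesis .
qed

lemma permutes_of_left_inverse:
  assumes "finite A" "\<And>x. x \<in> A \<Longrightarrow> f x \<in> A" "\<And>x. x \<in> A \<Longrightarrow> g (f x) = x" "\<And>x. x \<notin> A \<Longrightarrow> f x = x"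
  shows "f permutes A"
proof (rule bij_imp_permutes[OF _ assms(4)])
  have "inj_on f A" using assms(3) by (rule inj_on_inverseI)
  moreover have "f ` A = A" using assms(1,2) \<open>inj_on f A\<close> by (intro endo_inj_surj) auto
  ultimately show "bij_betw f A A" by (simp add: bij_betw_def)
qed

section \<open>Subsets invariant under a map\<close>

definition invariant_subsets :: "('a \<Rightarrow> 'a) \<Rightarrow> 'a set \<Rightarrow> 'a set set" where
  "invariant_subsets f A = {S. S \<subseteq> A \<and> f ` S = S}"

text \<open>An invariant set splits into its traces on \<open>A\<close> and \<open>B\<close>. Each
  trace is invariant: a point of it has a preimage in the set, and that preimage cannot lie in the
  other part.\<close>

lemma card_invariant_subsets_Un:
  assumes AB: "A \<inter> B = {}" "f ` A \<subseteq> A" "f ` B \<subseteq> B"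
  shows "card (invariant_subsets f (A \<union> B)) = card (invariant_subsets f A) * card (invariant_subsets f B)"
proof -
  have restrict: "f ` (S \<inter> C) = S \<inter> C"
    if CD: "C \<inter> D = {}" "f ` C \<subseteq> C" "f ` D \<subseteq> D" "S \<subseteq> C \<union> D" and S: "f ` S = S" for C D S
  proof
    show "f ` (S \<inter> C) \<subseteq> S \<inter> C" using CD S by blast
    show "S \<inter> C \<subseteq> f ` (S \<inter> C)"
    proof
      fix x assume x: "x \<in> S \<inter> C"
      then obtain y where y: "y \<in> S" "x = f y" using S by blast
      then have "y \<in> C" using CD x by blast
      then show "x \<in> f ` (S \<inter> C)" using y by blast
    qed
  qed
  have "bij_betw (\<lambda>S. (S \<inter> A, S \<inter> B)) (invariant_subsets f (A \<union> B))
      (invariant_subsets f A \<times> invariant_subsets f B)"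
  proof (rule bij_betw_byWitness[where f' = "\<lambda>(S, T). S \<union> T"])
    show "(\<lambda>S. (S \<inter> A, S \<inter> B)) ` invariant_subsets f (A \<union> B)
        \<subseteq> invariant_subsets f A \<times> invariant_subsets f B"
    proof (rule image_subsetI)
      fix S assume "S \<in> invariant_subsets f (A \<union> B)"
      then have S: "S \<subseteq> A \<union> B" "f ` S = S" by (auto simp: invariant_subsets_def)
      have "f ` (S \<inter> A) = S \<inter> A" by (rule restrict[OF AB S])
      moreover have "f ` (S \<inter> B) = S \<inter> B"
        by (rule restrict[where D = A]) (use AB S in \<open>simp_all add: Int_commute Un_commute\<close>)
      ultimately show "(S \<inter> A, S \<inter> B) \<in> invariant_subsets f A \<times> invariant_subsets f B"
        by (simp add: invariant_subsets_def)
    qed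
    show "(\<lambda>(S, T). S \<union> T) ` (invariant_subsets f A \<times> invariant_subsets f B)
        \<subseteq> invariant_subsets f (A \<union> B)"
      by (auto simp: invariant_subsets_def image_Un)
  qed (use AB in \<open>auto simp: invariant_subsets_def\<close>)
  then show ?thesis
    by (simp add: bij_betw_same_card card_cartesian_product)
qed

text \<open>This serves to strip the Boolean tag from vertices and to move the fixed point of an
  affine map to \<open>0\<close>.\<close>

lemma card_invariant_subsets_conj:
  assumes \<phi>: "bij_betw \<phi> A B" and f: "\<And>x. x \<in> A \<Longrightarrow> f x \<in> A"
    and conj: "\<And>x. x \<in> A \<Longrightarrow> g (\<phi> x) = \<phi> (f x)"
  shows "card (invariant_subsets f A) = card (invariant_subsets g B)"
proof (rule bij_betw_same_card)
  have inj: "inj_on \<phi> A" and im: "\<phi> ` A = B" using \<phi> by (auto simp: bij_betw_def)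
  have eq: "g ` \<phi> ` S = \<phi> ` S \<longleftrightarrow> f ` S = S" if "S \<subseteq> A" for S
  proof -
    have "g ` \<phi> ` S = \<phi> ` f ` S" using that conj by (force simp: image_image)
    moreover have "f ` S \<subseteq> A" using that f by blast
    ultimately show ?thesis using inj_on_image_eq_iff[OF inj _ that] by metis
  qed
  show "bij_betw ((`) \<phi>) (invariant_subsets f A) (invariant_subsets g B)"
    unfolding bij_betw_def
  proof
    show "inj_on ((`) \<phi>) (invariant_subsets f A)"
      using inj_on_image_Pow[OF inj] by (rule inj_on_subset) (auto simp: invariant_subsets_def)
    show "(`) \<phi> ` invariant_subsets f A = invariant_subsets g B"
    proof
      show "(`) \<phi> ` invariant_subsets f A \<subseteq> invariant_subsets g B"
        using eq im unfolding invariant_subsets_def by blast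
      show "invariant_subsets g B \<subseteq> (`) \<phi> ` invariant_subsets f A"
      proof
        fix T assume T: "T \<in> invariant_subsets g B"
        then obtain S where S: "S \<subseteq> A" "T = \<phi> ` S"
          using im by (metis (no_types, lifting) invariant_subsets_def mem_Collect_eq subset_imageE)
        then show "T \<in> (`) \<phi> ` invariant_subsets f A"
          using T eq[OF S(1)] by (simp add: invariant_subsets_def)
      qed
    qed
  qed
qed

lemma card_invariant_subsets_id:
  assumes "finite A" "\<And>x. x \<in> A \<Longrightarrow> f x = x"
  shows "card (invariant_subsets f A) = 2 ^ card A"
proof -
  have "invariant_subsets f A = Pow A"
    using assms(2) by (force simp: invariant_subsets_def)
  then show ?thesis using assms(1) by (simp add: card_Pow)
qed

section \<open>Cayley digraphs of the dihedral group in coordinates\<close>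

locale odd_prime =
  fixes p :: nat
  assumes prime: "prime p" and odd: "odd p"
begin

text \<open>Least residues model the field with \<open>p\<close> elements; \<open>U\<close> is its
  multiplicative group, and \<open>V\<close> holds the coordinates of the dihedral group.\<close>

abbreviation P :: int where "P \<equiv> int p"
abbreviation Z :: "int set" where "Z \<equiv> {0..<int p}"
abbreviation U :: "int set" where "U \<equiv> {1..<int p}"
abbreviation V :: "(int \<times> bool) set" where "V \<equiv> {0..<int p} \<times> UNIV"

lemma p_gt_2: "p > 2"
  using prime odd prime_ge_2_nat[OF prime] by (cases "p = 2") auto

lemma P_pos: "P > 0" using p_gt_2 by simp

lemma mod_P_bounds [simp]: "0 \<le> x mod P" "x mod P < P"
  using P_pos by simp_all

lemma mod_Z [simp]: "x \<in> Z \<Longrightarrow> x mod P = x"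
  by simp

lemma mod_mult_add_left: "(x mod P * i + b) mod P = (x * i + b) mod P"
  by (metis mod_add_left_eq mod_mult_left_eq)

lemma mod_mult_add_right: "(u * (x mod P) + b) mod P = (u * x + b) mod P"
  by (metis mod_add_left_eq mod_mult_right_eq)

lemma mod_add_mult: "(b + u * (x mod P)) mod P = (b + u * x) mod P" "(b + x mod P * u) mod P = (b + x * u) mod P"
  by (metis mod_add_right_eq mod_mult_right_eq) (metis mod_add_right_eq mod_mult_left_eq)

section \<open>Linear equations modulo \<open>p\<close>\<close>

lemma unit_inverse:
  assumes "\<not> P dvd u"
  obtains v where "[u * v = 1] (mod P)"
  using assms prime by (metis cong_solve_coprime_int coprime_commute prime_imp_coprime
    prime_int_nat_transfer prime_nat_int_transfer)

lemma U_not_dvd: "u \<in> U \<Longrightarrow> \<not> P dvd u"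
  by (auto dest: zdvd_imp_le)

lemma linear_solve:
  assumes "\<not> P dvd u"
  obtains i where "i \<in> Z" "(u * i) mod P = j mod P"
proof -
  obtain v where v: "[u * v = 1] (mod P)" using unit_inverse[OF assms] .
  have "[u * (v * j) = 1 * j] (mod P)"
    using cong_mult[OF v cong_refl[of j]] by (simp add: mult.assoc)
  then have "(u * ((v * j) mod P)) mod P = j mod P"
    by (simp add: cong_def mod_simps)
  then show ?thesis using that[of "(v * j) mod P"] by simp
qed

lemma linear_cancel:
  assumes "\<not> P dvd u" "x \<in> Z" "y \<in> Z" "(u * x + b) mod P = (u * y + b) mod P"
  shows "x = y"
proof -
  have "P dvd u * (x - y)"
    using assms(4) by (simp add: mod_eq_dvd_iff algebra_simps)
  then have "P dvd x - y"
    using assms(1) prime by (metis prime_dvd_mult_iff prime_nat_int_transfer)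
  then have "x mod P = y mod P" by (simp add: mod_eq_dvd_iff)
  then show ?thesis using assms by simp
qed

text \<open>The multiples of a nonzero \<open>d\<close> exhaust the residues, so one member of
  \<open>Q\<close> already reaches every residue.\<close>

lemma shift_invariant_trivial:
  assumes d: "\<not> P dvd d" and Q: "Q \<subseteq> Z"
    and inv: "\<And>j. j \<in> Z \<Longrightarrow> j \<in> Q \<longleftrightarrow> (j + d) mod P \<in> Q"
  shows "Q = {} \<or> Q = Z"
proof (rule ccontr)
  assume "\<not> ?thesis"
  then obtain i j where i: "i \<in> Q" and j: "j \<in> Z" "j \<notin> Q" using Q by blast
  have i': "i \<in> Z" using i Q by blast
  have *: "(i + int k * d) mod P \<in> Q" for k
  proof (induction k)
    case 0
    then show ?case using i i' by simp
  next
    case (Suc k)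
    then have "((i + int k * d) mod P + d) mod P \<in> Q"
      using iffD1[OF inv, of "(i + int k * d) mod P"] by simp
    then show ?case by (simp add: mod_simps algebra_simps)
  qed
  obtain k where k: "k \<in> Z" "(d * k) mod P = (j - i) mod P"
    using linear_solve[OF d] by blast
  have "(i + int (nat k) * d) mod P = (i + (d * k) mod P) mod P"
    using k(1) by (simp add: mod_simps mult.commute)
  also have "\<dots> = j" unfolding k(2) using j by (simp add: mod_simps)
  finally show False using * j by metis
qed

text \<open>The pair \<open>(i, s)\<close> stands for \<open>\<sigma>\<^sup>s \<tau>\<^sup>i\<close>; the pair tested below is then \<open>y x\<inverse>\<close>.\<close>

definition adj :: "(int \<times> bool) set \<Rightarrow> int \<times> bool \<Rightarrow> int \<times> bool \<Rightarrow> bool" where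
  "adj S x y \<longleftrightarrow>
    ((if snd x then fst x - fst y else fst y - fst x) mod P, snd x \<noteq> snd y) \<in> S"

abbreviation isos where "isos S T \<equiv> rel_isos V (adj S) (adj T)"

section \<open>Right translations and group automorphisms in coordinates\<close>

text \<open>Right multiplication by the \<open>k\<close>-th power of \<open>\<tau>\<close>, extended
  by the identity so that it permutes \<open>V\<close>.\<close>

definition rot :: "int \<Rightarrow> int \<times> bool \<Rightarrow> int \<times> bool" where
  "rot k x = (if x \<in> V then ((fst x + k) mod P, snd x) else x)"

text \<open>Right multiplication by \<open>\<sigma>\<close>: moving \<open>\<sigma>\<close> to the
  left past a power of \<open>\<tau>\<close> inverts that power.\<close>

definition flip :: "int \<times> bool \<Rightarrow> int \<times> bool" where
  "flip x = (if x \<in> V then ((- fst x) mod P, \<not> snd x) else x)"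

text \<open>For \<open>u\<close> in \<open>U\<close> this is the group automorphism that sends
  \<open>\<tau>\<close> to its \<open>u\<close>-th power and \<open>\<sigma>\<close> to
  \<open>\<sigma>\<close> times the \<open>b\<close>-th power of \<open>\<tau>\<close>.\<close>

definition aff :: "int \<Rightarrow> int \<Rightarrow> int \<times> bool \<Rightarrow> int \<times> bool" where
  "aff u b x = (if x \<in> V then ((u * fst x + (if snd x then b else 0)) mod P, snd x) else x)"

lemma finite_V: "finite V" by simp

lemma rot_comp: "rot k \<circ> rot l = rot (k + l)"
  by (auto simp: rot_def fun_eq_iff mod_simps algebra_simps P_pos)

lemma rot_0: "rot 0 = id"
  by (auto simp: rot_def fun_eq_iff)

lemma rot_cong: "k mod P = l mod P \<Longrightarrow> rot k = rot l"
  by (auto simp: rot_def fun_eq_iff intro: mod_add_cong)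

lemma funpow_rot: "rot k ^^ n = rot (int n * k)"
  by (induction n) (simp_all add: rot_0 rot_comp algebra_simps)

lemma rot_1_period: "rot 1 ^^ p = id"
  using rot_cong[of P 0] by (simp add: funpow_rot rot_0)

lemma rot_1_neq: "rot 1 \<noteq> id"
proof
  assume "rot 1 = id"
  then have "rot 1 (0, False) = (0, False)" by simp
  then show False using p_gt_2 by (simp add: rot_def)
qed

text \<open>A common right factor cancels in \<open>y x^-1\<close>, so right translations are
  automorphisms whatever the connection set is.\<close>

lemma rot_in_isos: "rot k \<in> isos S S"
proof -
  have "rot k permutes V"
    by (rule permutes_of_left_inverse[where g = "rot (- k)"]) (auto simp: rot_def mod_simps P_pos)
  then show ?thesis
    by (auto simp: rel_isos_def adj_def rot_def mod_simps)
qed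

lemma flip_in_isos: "flip \<in> isos S S"
proof -
  have "flip permutes V"
    by (rule permutes_of_left_inverse[where g = flip]) (auto simp: flip_def mod_simps P_pos)
  then show ?thesis
    by (auto simp: rel_isos_def adj_def flip_def mod_simps)
qed

lemma normalises_rot: "normalises (rot k) (rot 1)"
  unfolding normalises_def by (rule exI[of _ 1]) (simp add: rot_comp add.commute)

lemma normalises_flip: "normalises flip (rot 1)"
proof -
  have "flip \<circ> rot 1 = rot (-1) \<circ> flip"
    by (auto simp: flip_def rot_def fun_eq_iff mod_simps P_pos)
  \<comment> \<open>The exponent \<open>-1\<close> is replaced by \<open>p - 1\<close>, because
    \<open>normalises\<close> asks for a natural power.\<close>
  also have "rot (-1) = rot (int (p - 1) * 1)"
    using p_gt_2 by (intro rot_cong) (simp add: of_nat_diff mod_eq_dvd_iff)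
  finally show ?thesis
    unfolding normalises_def funpow_rot by blast
qed

text \<open>Right translations act transitively. Since \<open>g\<close> does not depend on
  \<open>S\<close>, it is an automorphism of source and target alike.\<close>

lemma translation_exists:
  assumes "v \<in> V" "w \<in> V"
  obtains g where "\<And>S. g \<in> isos S S" "normalises g (rot 1)" "g v = w"
proof -
  \<comment> \<open>Across cosets \<open>flip\<close> comes after \<open>rot k\<close>, so
    \<open>k\<close> has to satisfy \<open>- (fst v + k) = fst w\<close>.\<close>
  define k where "k = (if snd v = snd w then fst w - fst v else - fst w - fst v)"
  define g where "g = (if snd v = snd w then id else flip) \<circ> rot k"
  have "g \<in> isos S S" for S
    unfolding g_def by (intro rel_isos_comp[of _ _ _ "adj S"] rot_in_isos) (simp add: rel_isos_id flip_in_isos)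
  moreover have "normalises g (rot 1)"
    unfolding g_def by (intro normalises_comp normalises_rot) (simp add: normalises_id normalises_flip)
  moreover have "g v = w"
    using assms P_pos by (cases v; cases w) (auto simp: g_def k_def rot_def flip_def mod_simps)
  ultimately show ?thesis using that by blast
qed

section \<open>The normaliser of the rotations and the all-or-none property\<close>

text \<open>The relation \<open>f t = t^c f\<close> determines \<open>f\<close> on each of the two
  orbits of \<open>rot 1\<close> from a single value. The value at the origin is prescribed, and the
  value at \<open>(0, True)\<close> supplies \<open>b\<close>.\<close>

lemma normaliser_fixing_origin_is_aff:
  assumes f: "f permutes V" "normalises f (rot 1)" "f (0, False) = (0, False)"
  obtains u b where "u \<in> U" "b \<in> Z" "f = aff u b"
proof -
  obtain c where c: "f \<circ> rot 1 = rot 1 ^^ c \<circ> f"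
    using f by (auto simp: normalises_def)
  have step: "f (i, s) = rot (int c * i) (f (0, s))" if "i \<in> Z" for i s
  proof -
    have "(i, s) = (rot 1 ^^ nat i) (0, s)"
      using that by (simp add: funpow_rot rot_def)
    then have "f (i, s) = (f \<circ> rot 1 ^^ nat i) (0, s)" by simp
    also have "\<dots> = (((rot 1 ^^ c) ^^ nat i) \<circ> f) (0, s)"
      by (simp only: intertwine_funpow[OF c])
    also have "(rot 1 ^^ c) ^^ nat i = rot (int c * i)"
      using that by (simp add: funpow_rot mult.commute)
    finally show ?thesis by simp
  qed
  have inj: "inj f" using f permutes_inj by blast
  define u where "u = int c mod P"
  have f0: "f (i, False) = (u * i mod P, False)" if "i \<in> Z" for i
    using step[OF that, of False] that f(3) by (simp add: u_def rot_def mod_simps)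
  have "u \<noteq> 0"
  proof
    assume "u = 0"
    then have "f (1, False) = f (0, False)" using f0[of 1] f0[of 0] p_gt_2 by simp
    from injD[OF inj this] show False by simp
  qed
  then have u: "u \<in> U"
    using mod_P_bounds[of "int c"] unfolding u_def atLeastLessThan_iff by linarith
  obtain b s where bs: "f (0, True) = (b, s)" by (cases "f (0, True)")
  have "f (0, True) \<in> V" using P_pos permutes_in_image[OF f(1)] by simp
  then have b: "b \<in> Z" using bs by simp
  \<comment> \<open>Otherwise \<open>f (0, True)\<close> would lie in the first orbit, all of which
    is already taken by the values \<open>f (i, False)\<close>.\<close>
  have s: "s"
  proof (rule ccontr)
    assume "\<not> s"
    obtain i where "i \<in> Z" "(u * i) mod P = b mod P"
      using linear_solve[OF U_not_dvd[OF u]] by blast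
    then have "f (i, False) = f (0, True)" using f0 b bs \<open>\<not> s\<close> by simp
    from injD[OF inj this] show False by simp
  qed
  have f1: "f (i, True) = ((u * i + b) mod P, True)" if "i \<in> Z" for i
    using step[OF that, of True] that bs s b by (simp add: u_def rot_def mod_mult_add_left add.commute[of b])
  have "f = aff u b"
    using f0 f1 f(1) by (auto simp: fun_eq_iff aff_def permutes_not_in)
  then show ?thesis using that u b by blast
qed

text \<open>A connection set is the out-neighbourhood of the identity, here
  \<open>(0, False)\<close>.\<close>

lemma iso_fixing_origin_image:
  assumes f: "f \<in> isos S T" "f (0, False) = (0, False)" and S: "S \<subseteq> V" "T \<subseteq> V"
  shows "f ` S = T"
proof -
  have 0: "(0, False) \<in> V" using P_pos by simp
  have adj0: "adj Q (0, False) y \<longleftrightarrow> y \<in> Q" if "y \<in> V" for Q y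
    using that by (cases y) (auto simp: adj_def)
  have p: "f permutes V" using f(1) by (rule rel_isos_permutes)
  have "y \<in> S \<longleftrightarrow> f y \<in> T" if "y \<in> V" for y
  proof -
    have "adj S (0, False) y \<longleftrightarrow> adj T (f (0, False)) (f y)"
      using f(1) that 0 unfolding rel_isos_def by blast
    then show ?thesis
      using adj0[OF that] adj0[of "f y"] f(2) that permutes_in_image[OF p] by simp
  qed
  then have "f ` S = f ` V \<inter> T" using S by blast
  also have "\<dots> = T" using permutes_image[OF p] S by blast
  finally show ?thesis .
qed

text \<open>A right translation of the target brings the image of the origin back, and it normalises
  the rotations itself.\<close>

lemma isos_fixing_origin:
  assumes f: "f \<in> isos S T"
  obtains g where "g \<in> isos S T" "g (0, False) = (0, False)"
    "normalises f (rot 1) \<Longrightarrow> normalises g (rot 1)"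
proof -
  have 0: "(0, False) \<in> V" using P_pos by simp
  then have "f (0, False) \<in> V" using permutes_in_image[OF rel_isos_permutes[OF f]] by simp
  then obtain h where h: "\<And>S. h \<in> isos S S" "normalises h (rot 1)" "h (f (0, False)) = (0, False)"
    using translation_exists 0 by metis
  show ?thesis
    by (rule that[of "h \<circ> f"]) (use h f in \<open>auto intro: rel_isos_comp normalises_comp\<close>)
qed

lemma card_eq_if_iso:
  assumes "f \<in> isos S T" "S \<subseteq> V" "T \<subseteq> V"
  shows "card S = card T"
proof -
  obtain g where g: "g \<in> isos S T" "g (0, False) = (0, False)"
    using isos_fixing_origin[OF assms(1)] by blast
  then have "g ` S = T" using iso_fixing_origin_image assms by blast
  moreover have "inj g" using rel_isos_permutes[OF g(1)] permutes_inj by blast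
  ultimately show ?thesis by (metis card_image inj_on_subset subset_UNIV)
qed

lemma aff_image_if_normalising_iso:
  assumes f: "f \<in> isos S T" "normalises f (rot 1)" and S: "S \<subseteq> V" "T \<subseteq> V"
  shows "\<exists>u\<in>U. \<exists>b\<in>Z. aff u b ` S = T"
proof -
  obtain g where g: "g \<in> isos S T" "g (0, False) = (0, False)" "normalises g (rot 1)"
    by (rule isos_fixing_origin[OF f(1)]) (use f(2) in simp)
  obtain u b where "u \<in> U" "b \<in> Z" "g = aff u b"
    using normaliser_fixing_origin_is_aff[OF rel_isos_permutes[OF g(1)] g(3,2)] .
  then show ?thesis using iso_fixing_origin_image[OF g(1,2) S] by blast
qed

text \<open>\<open>N\<close> contains a transitive group of translations, so the
  \<open>2 * p\<close> sets of maps with a prescribed image of the origin are equally large.\<close>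

lemma card_normaliser_fixing_origin:
  fixes S :: "(int \<times> bool) set"
  defines "N \<equiv> {f \<in> isos S S. normalises f (rot 1)}"
  shows "card N = 2 * p * card {f \<in> N. f (0, False) = (0, False)}"
proof -
  define N_at where "N_at v = {f \<in> N. f (0, False) = v}" for v
  have fin: "finite N" using finite_rel_isos[OF finite_V] by (simp add: N_def)
  have 0: "(0, False) \<in> V" using P_pos by simp
  have le: "card (N_at v) \<le> card (N_at w)" if vw: "v \<in> V" "w \<in> V" for v w
  proof -
    obtain g where g: "\<And>S. g \<in> isos S S" "normalises g (rot 1)" "g v = w"
      using translation_exists[OF vw] by metis
    have bg: "bij g" using permutes_bij[OF rel_isos_permutes[OF g(1)]] .
    show ?thesis
    proof (rule card_inj_on_le)
      show "inj_on ((\<circ>) g) (N_at v)"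
        using bij_comp_left_cancel[OF bg] by (blast intro: inj_onI)
      show "(\<circ>) g ` N_at v \<subseteq> N_at w"
        using g by (auto simp: N_at_def N_def intro: rel_isos_comp normalises_comp)
      show "finite (N_at w)" using fin by (simp add: N_at_def)
    qed
  qed
  have "N = (\<Union>v\<in>V. N_at v)"
  proof -
    have "f (0, False) \<in> V" if "f \<in> N" for f
      using that 0 permutes_in_image[OF rel_isos_permutes, of f V _ _ "(0, False)"]
      unfolding N_def by blast
    then show ?thesis by (auto simp: N_at_def)
  qed
  then have "card N = card (\<Union>v\<in>V. N_at v)" by simp
  also have "\<dots> = (\<Sum>v\<in>V. card (N_at v))"
    by (rule card_UN_disjoint) (use fin in \<open>auto simp: N_at_def\<close>)
  also have "\<dots> = (\<Sum>v\<in>V. card (N_at (0, False)))"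
    by (rule sum.cong) (use le 0 in \<open>auto intro!: antisym\<close>)
  also have "\<dots> = 2 * p * card (N_at (0, False))"
    by (simp add: card_cartesian_product)
  finally show ?thesis by (simp add: N_at_def)
qed

text \<open>Discarding the non-normalising automorphisms leaves \<open>p^2\<close> dividing
  \<open>2 * p * card N0\<close>, so \<open>N0\<close> has at least \<open>p\<close> elements. Two
  of them agree in \<open>u\<close> and differ in \<open>b\<close>; both preserve \<open>S\<close>,
  so the reflections in \<open>S\<close> are invariant under a nonzero shift.\<close>

lemma reflections_all_or_none:
  assumes S: "S \<subseteq> V" and dvd: "p ^ 2 dvd card (isos S S)"
  shows "(\<forall>i\<in>Z. (i, True) \<in> S) \<or> (\<forall>i\<in>Z. (i, True) \<notin> S)"
proof -
  define N where "N = {f \<in> isos S S. normalises f (rot 1)}"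
  define N0 where "N0 = {f \<in> N. f (0, False) = (0, False)}"
  have fin: "finite (isos S S)" using finite_rel_isos[OF finite_V] .
  have "p ^ 2 dvd card {f \<in> isos S S. \<not> normalises f (rot 1)}"
    using prime_square_dvd_card_non_normalising[OF prime finite_V rot_in_isos rot_in_isos rot_1_period rot_1_neq] .
  moreover have "card (isos S S) = card N + card {f \<in> isos S S. \<not> normalises f (rot 1)}"
    unfolding N_def using card_filter_split[OF fin] .
  ultimately have "p ^ 2 dvd card N"
    using dvd dvd_add_left_iff[of "p ^ 2" "card {f \<in> isos S S. \<not> normalises f (rot 1)}" "card N"]
    by presburger
  also have "card N = 2 * p * card N0"
    unfolding N0_def N_def by (rule card_normaliser_fixing_origin)
  finally have "p * p dvd p * (2 * card N0)"
    by (simp add: power2_eq_square mult_ac)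
  then have "p dvd 2 * card N0" using p_gt_2 by simp
  then have "p dvd card N0"
    using prime p_gt_2 by (metis prime_dvd_mult_iff nat_dvd_not_less zero_less_numeral)
  moreover have finN0: "finite N0" using fin by (simp add: N0_def N_def)
  moreover have "id \<in> N0" by (simp add: N0_def N_def rel_isos_id normalises_id)
  ultimately have "p \<le> card N0"
    by (intro dvd_imp_le) (auto simp: card_gt_0_iff)
  have ex: "\<exists>u b. u \<in> U \<and> b \<in> Z \<and> f = aff u b" if "f \<in> N0" for f
    using normaliser_fixing_origin_is_aff[OF rel_isos_permutes, of f "adj S" "adj S"] that
    unfolding N0_def N_def by blast
  then obtain lin tr where lt: "\<And>f. f \<in> N0 \<Longrightarrow> lin f \<in> U \<and> tr f \<in> Z \<and> f = aff (lin f) (tr f)"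
    by metis
  \<comment> \<open>Pigeonhole: only \<open>p - 1\<close> linear factors are available for at least
    \<open>p\<close> maps.\<close>
  have "card (lin ` N0) \<le> card U"
    using lt by (intro card_mono) auto
  then have "card (lin ` N0) < card N0"
    using \<open>p \<le> card N0\<close> p_gt_2 by simp
  then have "\<not> inj_on lin N0" using card_image by fastforce
  then obtain f g where fg: "f \<in> N0" "g \<in> N0" "f \<noteq> g" "lin f = lin g"
    by (auto simp: inj_on_def)
  define u b c where "u = lin f" and "b = tr f" and "c = tr g"
  have f: "f = aff u b" and g: "g = aff u c" and u: "u \<in> U" and b: "b \<in> Z" "c \<in> Z"
    using lt[OF fg(1)] lt[OF fg(2)] fg(4) by (auto simp: u_def b_def c_def)
  have "b \<noteq> c" using f g fg(3) by auto
  then have nd: "\<not> P dvd c - b"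
    using b by (metis mod_Z mod_eq_dvd_iff)
  have image: "h ` S = S" if "h \<in> N0" for h
    using iso_fixing_origin_image[OF _ _ S S] that by (auto simp: N0_def N_def)
  have mem: "x \<in> S \<longleftrightarrow> h x \<in> S" if "h \<in> N0" for h x
  proof -
    have "h permutes V" using that rel_isos_permutes by (auto simp: N0_def N_def)
    then show ?thesis using image[OF that] inj_image_mem_iff[of h x S] permutes_inj by metis
  qed
  define Q where "Q = {i \<in> Z. (i, True) \<in> S}"
  have inv: "j \<in> Q \<longleftrightarrow> (j + (c - b)) mod P \<in> Q" if j: "j \<in> Z" for j
  proof -
    \<comment> \<open>The reflection \<open>i\<close> is the one that \<open>f\<close> sends to
      \<open>j\<close>; \<open>g\<close> then sends it to \<open>j + (c - b)\<close>.\<close>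
    obtain i where i: "i \<in> Z" "(u * i) mod P = (j - b) mod P"
      using linear_solve[OF U_not_dvd[OF u]] by blast
    have *: "(u * i + d) mod P = (j - b + d) mod P" for d
      using i(2) by (metis mod_add_left_eq)
    have "f (i, True) = (j, True)" "g (i, True) = ((j + (c - b)) mod P, True)"
      using i(1) j *[of b] *[of c] by (simp_all add: f g aff_def algebra_simps)
    then have "(j, True) \<in> S \<longleftrightarrow> ((j + (c - b)) mod P, True) \<in> S"
      using mem[OF fg(1), of "(i, True)"] mem[OF fg(2), of "(i, True)"] by simp
    then show ?thesis using j by (simp add: Q_def)
  qed
  have "Q \<subseteq> Z" by (auto simp: Q_def)
  from shift_invariant_trivial[OF nd this inv] have "Q = {} \<or> Q = Z" .
  then show ?thesis by (auto simp: Q_def)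
qed

section \<open>Circulant digraphs and connection sets without reflections\<close>

text \<open>If no isomorphism normalised the translations, \<open>p^2\<close> would divide the order
  of an automorphism group inside the symmetric group on \<open>p\<close> points. A normalising
  isomorphism has the form \<open>x -> u x + g 0\<close>, and its multiplier carries
  \<open>S\<close> to \<open>T\<close>.\<close>

lemma circulant_isomorphism:
  assumes S: "S \<subseteq> Z" "T \<subseteq> Z"
    and f: "f \<in> rel_isos Z (\<lambda>x y. (y - x) mod P \<in> S) (\<lambda>x y. (y - x) mod P \<in> T)"
  shows "\<exists>u\<in>U. (\<lambda>x. u * x mod P) ` S = T"
proof -
  define circ where "circ Q = (\<lambda>x y. (y - x) mod P \<in> Q)" for Q :: "int set"
  define t where "t k x = (if x \<in> Z then (x + k) mod P else x)" for k x
  have t_comp: "t k \<circ> t l = t (k + l)" for k l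
    by (auto simp: t_def fun_eq_iff mod_simps algebra_simps)
  have t_0: "t 0 = id"
    by (auto simp: t_def fun_eq_iff)
  have t_pow: "t k ^^ n = t (int n * k)" for k n
    by (induction n) (simp_all add: t_0 t_comp algebra_simps)
  have "t k permutes Z" for k
    by (rule permutes_of_left_inverse[where g = "t (- k)"]) (auto simp: t_def mod_simps)
  then have t_isos: "t k \<in> rel_isos Z (circ Q) (circ Q)" for k Q
    by (auto simp: rel_isos_def circ_def t_def mod_simps)
  have t_p: "t 1 ^^ p = id"
    by (auto simp: t_pow t_def fun_eq_iff)
  have t_1: "t 1 \<noteq> id"
  proof
    assume "t 1 = id"
    then have "t 1 0 = 0" by simp
    then show False using p_gt_2 by (simp add: t_def)
  qed
  have f: "f \<in> rel_isos Z (circ S) (circ T)" using f by (simp add: circ_def)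
  have "\<exists>g \<in> rel_isos Z (circ S) (circ T). normalises g (t 1)"
  proof (rule ccontr)
    assume "\<not> ?thesis"
    then have "{g \<in> rel_isos Z (circ S) (circ T). \<not> normalises g (t 1)} = rel_isos Z (circ S) (circ T)"
      by blast
    then have "p ^ 2 dvd card (rel_isos Z (circ S) (circ T))"
      using prime_square_dvd_card_non_normalising[OF prime _ t_isos t_isos t_p t_1, of S T] by simp
    then have "p ^ 2 dvd card (rel_isos Z (circ S) (circ S))"
      using card_rel_isos_source[OF f] by simp
    also have "\<dots> dvd fact (card Z)"
      by (rule card_perm_group_dvd_fact)
        (auto intro: rel_isos_id rel_isos_comp rel_isos_inv rel_isos_permutes)
    \<comment> \<open>Cancelling one factor \<open>p\<close> would leave \<open>p\<close> dividing
      \<open>fact (p - 1)\<close>.\<close>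
    also have "fact (card Z) = p * fact (p - 1)"
      using p_gt_2 by (simp add: fact_reduce)
    finally have "p dvd fact (p - 1)"
      using p_gt_2 by (simp add: power2_eq_square)
    then show False
      using prime p_gt_2 by (simp add: prime_dvd_fact_iff)
  qed
  then obtain g c where g: "g \<in> rel_isos Z (circ S) (circ T)" and c: "g \<circ> t 1 = t 1 ^^ c \<circ> g"
    by (auto simp: normalises_def)
  have gp: "g permutes Z" using rel_isos_permutes[OF g] .
  have 0: "0 \<in> Z" using P_pos by simp
  have g0: "g 0 \<in> Z" using permutes_in_image[OF gp] 0 by blast
  define u where "u = int c mod P"
  have g_eq: "g i = (u * i + g 0) mod P" if "i \<in> Z" for i
  proof -
    have "i = (t 1 ^^ nat i) 0" using that P_pos by (simp add: t_pow t_def)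
    then have "g i = (g \<circ> t 1 ^^ nat i) 0" by simp
    also have "\<dots> = ((t 1 ^^ c) ^^ nat i) (g 0)"
      by (simp only: intertwine_funpow[OF c]) simp
    also have "(t 1 ^^ c) ^^ nat i = t (int c * i)"
      using that by (simp add: t_pow mult.commute)
    finally show ?thesis using g0 by (simp add: t_def u_def mod_add_mult add.commute)
  qed
  have "u \<noteq> 0"
  proof
    assume "u = 0"
    then have "g 1 = g 0" using g_eq[of 1] g_eq[of 0] p_gt_2 by simp
    from injD[OF permutes_inj[OF gp] this] show False by simp
  qed
  then have u: "u \<in> U"
    using mod_P_bounds[of "int c"] unfolding u_def atLeastLessThan_iff by linarith
  have mem: "i \<in> S \<longleftrightarrow> u * i mod P \<in> T" if i: "i \<in> Z" for i
  proof -
    \<comment> \<open>The constant \<open>g 0\<close> cancels in the difference that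
      \<open>circ\<close> tests.\<close>
    have "circ S 0 i \<longleftrightarrow> circ T (g 0) (g i)"
      using g i 0 unfolding rel_isos_def by blast
    then show ?thesis using i by (simp add: circ_def g_eq[OF i] mod_simps)
  qed
  have "(\<lambda>x. u * x mod P) ` S = T"
  proof
    show "(\<lambda>x. u * x mod P) ` S \<subseteq> T" using mem S by blast
    show "T \<subseteq> (\<lambda>x. u * x mod P) ` S"
    proof
      fix j assume j: "j \<in> T"
      obtain i where i: "i \<in> Z" "(u * i) mod P = j mod P"
        using linear_solve[OF U_not_dvd[OF u]] by blast
      moreover have "j mod P = j" using j S by (intro mod_Z) blast
      ultimately show "j \<in> (\<lambda>x. u * x mod P) ` S"
        using mem[OF i(1)] j by (auto intro!: image_eqI[of _ _ i])
    qed
  qed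
  then show ?thesis using u by blast
qed

text \<open>An isomorphism fixing the identity maps the coset of the powers of \<open>\<tau>\<close>
  to itself when \<open>S\<close> is nonempty, and restricts there to an isomorphism of circulants.
  As \<open>S\<close> and \<open>T\<close> lie in this coset, its multiplier suffices.\<close>

lemma iso_without_reflections:
  assumes f: "f \<in> isos S T" and S: "S \<subseteq> U \<times> {False}" and T: "T \<subseteq> U \<times> {False}"
  shows "\<exists>u\<in>U. \<exists>b\<in>Z. aff u b ` S = T"
proof -
  have SV: "S \<subseteq> V" "T \<subseteq> V" using S T by auto
  obtain g where g: "g \<in> isos S T" "g (0, False) = (0, False)"
    using isos_fixing_origin[OF f] by blast
  have gp: "g permutes V" using rel_isos_permutes[OF g(1)] .
  have ginV: "g x \<in> V" if "x \<in> V" for x using permutes_in_image[OF gp] that by blast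
  have gadj: "adj S x y \<longleftrightarrow> adj T (g x) (g y)" if "x \<in> V" "y \<in> V" for x y
    using g(1) that unfolding rel_isos_def by blast
  show ?thesis
  proof (cases "S = {}")
    case True
    then have "T = {}" using iso_fixing_origin_image[OF g SV] by simp
    moreover have "1 \<in> U" "0 \<in> Z" using p_gt_2 by auto
    ultimately show ?thesis using True by blast
  next
    case False
    then obtain s where s: "(s, False) \<in> S" "s \<in> U" using S by blast
    \<comment> \<open>Without reflections there are no arcs between the two cosets, and each coset is connected.\<close>
    have same: "\<not> snd (g ((int k * s) mod P, False))" for k
    proof (induction k)
      case 0
      then show ?case by (simp add: g)
    next
      case (Suc k)
      let ?x = "((int k * s) mod P, False)" and ?y = "((int (Suc k) * s) mod P, False)"
      have "((int (Suc k) * s) mod P - (int k * s) mod P) mod P = s"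
        using s(2) by (simp add: mod_simps algebra_simps)
      then have "adj S ?x ?y" using s(1) by (simp add: adj_def)
      then have "adj T (g ?x) (g ?y)" using gadj[of ?x ?y] by simp
      then have "snd (g ?x) = snd (g ?y)" using T by (auto simp: adj_def)
      then show ?case using Suc by simp
    qed
    have coset: "\<not> snd (g (i, False))" if i: "i \<in> Z" for i
    proof -
      \<comment> \<open>Every residue is a multiple of the nonzero \<open>s\<close>, so the path of
        steps \<open>s\<close> from the identity visits the whole coset.\<close>
      obtain k where k: "k \<in> Z" "(s * k) mod P = i mod P"
        using linear_solve[OF U_not_dvd[OF s(2)]] by blast
      then have "(int (nat k) * s) mod P = i" using i by (simp add: mult.commute)
      then show ?thesis using same[of "nat k"] by simp
    qed
    define h where "h i = (if i \<in> Z then fst (g (i, False)) else i)" for i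
    have g_h: "g (i, False) = (h i, False)" if "i \<in> Z" for i
      using coset[OF that] that by (simp add: h_def prod_eq_iff)
    have hZ: "h i \<in> Z" if "i \<in> Z" for i
      using g_h[OF that] ginV[of "(i, False)"] that by auto
    have "h permutes Z"
    proof (rule permutes_of_left_inverse[where g = "\<lambda>i. fst (Hilbert_Choice.inv g (i, False))"])
      show "fst (Hilbert_Choice.inv g (h i, False)) = i" if "i \<in> Z" for i
        using g_h[OF that] permutes_inverses(2)[OF gp, of "(i, False)"] by simp
    qed (use hZ in \<open>auto simp: h_def\<close>)
    define S0 T0 where "S0 = fst ` S" and "T0 = fst ` T"
    have S0: "S = S0 \<times> {False}" "T = T0 \<times> {False}" using S T by (force simp: S0_def T0_def)+
    have "h \<in> rel_isos Z (\<lambda>x y. (y - x) mod P \<in> S0) (\<lambda>x y. (y - x) mod P \<in> T0)"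
      unfolding rel_isos_def
    proof (intro CollectI conjI ballI)
      fix x y assume xy: "x \<in> Z" "y \<in> Z"
      have "adj S (x, False) (y, False) \<longleftrightarrow> adj T (h x, False) (h y, False)"
        using gadj[of "(x, False)" "(y, False)"] xy g_h by simp
      then show "(y - x) mod P \<in> S0 \<longleftrightarrow> (h y - h x) mod P \<in> T0"
        by (simp add: adj_def S0)
    qed fact
    then obtain u where u: "u \<in> U" "(\<lambda>x. u * x mod P) ` S0 = T0"
      using circulant_isomorphism[of S0 T0 h] S T by (force simp: S0_def T0_def)
    \<comment> \<open>The shift only affects reflections, and \<open>S\<close> has none, so
      \<open>0\<close> is a convenient choice.\<close>
    have "aff u 0 x = (u * fst x mod P, False)" if "x \<in> S" for x
      using that SV S by (auto simp: aff_def)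
    then have "aff u 0 ` S = (\<lambda>x. (u * fst x mod P, False)) ` S" by simp
    also have "\<dots> = T" unfolding S0 u(2)[symmetric] by (auto simp: image_iff)
    finally have "aff u 0 ` S = T" .
    moreover have "0 \<in> Z" using P_pos by simp
    ultimately show ?thesis using u(1) by blast
  qed
qed

section \<open>Group automorphisms as digraph isomorphisms, and the converse\<close>

lemma aff_permutes:
  assumes "u \<in> U"
  shows "aff u b permutes V"
proof (rule bij_imp_permutes)
  have "inj_on (aff u b) V"
  proof (rule inj_onI)
    fix x y assume xy: "x \<in> V" "y \<in> V" "aff u b x = aff u b y"
    then have "snd x = snd y" by (simp add: aff_def)
    moreover have "fst x = fst y"
    proof (rule linear_cancel[OF U_not_dvd[OF assms]])
      show "fst x \<in> Z" "fst y \<in> Z" using xy(1,2) by (simp_all add: mem_Times_iff)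
      show "(u * fst x + (if snd y then b else 0)) mod P = (u * fst y + (if snd y then b else 0)) mod P"
        using xy \<open>snd x = snd y\<close> unfolding aff_def by simp
    qed
    ultimately show "x = y" by (simp add: prod_eq_iff)
  qed
  moreover have "aff u b ` V \<subseteq> V" by (auto simp: aff_def)
  ultimately show "bij_betw (aff u b) V V"
    using endo_inj_surj[OF finite_V] by (auto simp: bij_betw_def)
qed (simp add: aff_def)

text \<open>A group automorphism commutes with forming \<open>y x^-1\<close>, whose coordinates are
  \<open>?q x y\<close>.\<close>

lemma aff_in_isos:
  assumes u: "u \<in> U" and S: "S \<subseteq> V"
  shows "aff u b \<in> isos S (aff u b ` S)"
  unfolding rel_isos_def
proof (intro CollectI conjI ballI)
  let ?f = "aff u b"
  show p: "?f permutes V" using aff_permutes[OF u] .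
  fix x y assume xy: "x \<in> V" "y \<in> V"
  let ?q = "\<lambda>x y. ((if snd x then fst x - fst y else fst y - fst x) mod P, snd x \<noteq> snd y)"
  have "?f (?q x y) = ?q (?f x) (?f y)"
    using xy by (cases "snd x"; cases "snd y")
      (auto simp: aff_def mod_simps mod_add_mult algebra_simps)
  then show "adj S x y \<longleftrightarrow> adj (?f ` S) (?f x) (?f y)"
    unfolding adj_def using inj_image_mem_iff[OF permutes_inj[OF p]] by metis
qed

text \<open>The coordinates of the non-identity elements, so the admissible connection sets are the
  subsets of \<open>W\<close>.\<close>

abbreviation W where "W \<equiv> V - {(0, False)}"

lemma aff_image_W:
  assumes "u \<in> U"
  shows "aff u b ` W = W"
proof -
  have "aff u b ` W = aff u b ` V - aff u b ` {(0, False)}"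
    using permutes_inj[OF aff_permutes[OF assms]] by (rule image_set_diff)
  also have "aff u b ` {(0, False)} = {(0, False)}"
    using P_pos by (simp add: aff_def)
  finally show ?thesis by (simp only: permutes_image[OF aff_permutes[OF assms]])
qed

text \<open>The complement within \<open>W\<close> gives the complementary loop-free digraph. This
  turns a connection set with all reflections into one with none.\<close>

lemma isos_complement:
  assumes "f \<in> isos S T" "S \<subseteq> W" "T \<subseteq> W"
  shows "f \<in> isos (W - S) (W - T)"
proof -
  have adj_c: "adj (W - Q) x y \<longleftrightarrow> x \<noteq> y \<and> \<not> adj Q x y" if "x \<in> V" "y \<in> V" "Q \<subseteq> W" for Q x y
  proof -
    have "(fst x - fst y) mod P = 0 \<longleftrightarrow> fst x = fst y" "(fst y - fst x) mod P = 0 \<longleftrightarrow> fst x = fst y"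
      using that mod_eq_dvd_iff[of "fst x" P "fst y"] mod_eq_dvd_iff[of "fst y" P "fst x"]
      by (auto simp: dvd_eq_mod_eq_0[symmetric])
    then show ?thesis using that(3) by (cases x; cases y) (auto simp: adj_def)
  qed
  have p: "f permutes V" using rel_isos_permutes[OF assms(1)] .
  have "f x = f y \<longleftrightarrow> x = y" for x y using permutes_inj[OF p] by (auto dest: injD)
  then show ?thesis
    using assms adj_c permutes_in_image[OF p] unfolding rel_isos_def by simp
qed

text \<open>The CI property for digraphs on the dihedral group. Without a normalising isomorphism,
  \<open>p^2\<close> divides both automorphism group orders, so each of \<open>S\<close> and
  \<open>T\<close> has all reflections or none. Their common size decides which, since sets with
  none have fewer than \<open>p\<close> elements; the case of all reflections is
  complementary.\<close>

theorem iso_iff_aff_image: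
  assumes S: "S \<subseteq> W" "T \<subseteq> W"
  shows "isos S T \<noteq> {} \<longleftrightarrow> (\<exists>u\<in>U. \<exists>b\<in>Z. aff u b ` S = T)"
proof
  assume "\<exists>u\<in>U. \<exists>b\<in>Z. aff u b ` S = T"
  then show "isos S T \<noteq> {}" using aff_in_isos S by blast
next
  assume "isos S T \<noteq> {}"
  then obtain f where f: "f \<in> isos S T" by blast
  have SV: "S \<subseteq> V" "T \<subseteq> V" using S by auto
  show "\<exists>u\<in>U. \<exists>b\<in>Z. aff u b ` S = T"
  proof (cases "\<exists>g\<in>isos S T. normalises g (rot 1)")
    case True
    then show ?thesis using aff_image_if_normalising_iso SV by blast
  next
    case False
    then have "{g \<in> isos S T. \<not> normalises g (rot 1)} = isos S T" by blast
    then have dvd: "p ^ 2 dvd card (isos S T)"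
      using prime_square_dvd_card_non_normalising[OF prime finite_V rot_in_isos rot_in_isos rot_1_period rot_1_neq, of S T]
      by simp
    have aonS: "(\<forall>i\<in>Z. (i, True) \<in> S) \<or> (\<forall>i\<in>Z. (i, True) \<notin> S)"
      by (rule reflections_all_or_none[OF SV(1)]) (use dvd card_rel_isos_source[OF f] in simp)
    have aonT: "(\<forall>i\<in>Z. (i, True) \<in> T) \<or> (\<forall>i\<in>Z. (i, True) \<notin> T)"
      by (rule reflections_all_or_none[OF SV(2)]) (use dvd card_rel_isos_target[OF f] in simp)
    have none: "Q \<subseteq> U \<times> {False}" if "Q \<subseteq> W" "\<forall>i\<in>Z. (i, True) \<notin> Q" for Q
    proof
      fix x assume x: "x \<in> Q"
      then have "\<not> snd x" "x \<in> W" using that by (cases x; auto)+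
      then show "x \<in> U \<times> {False}" by (cases x) auto
    qed
    have small: "card Q < p" if "Q \<subseteq> W" "\<forall>i\<in>Z. (i, True) \<notin> Q" for Q
    proof -
      have "card Q \<le> card (U \<times> {False})" using none[OF that] by (intro card_mono) auto
      then show ?thesis using p_gt_2 by (simp add: card_cartesian_product)
    qed
    have large: "p \<le> card Q" if "Q \<subseteq> W" "\<forall>i\<in>Z. (i, True) \<in> Q" for Q
    proof -
      have "finite Q" using that(1) by (rule finite_subset) simp
      then have "card (Z \<times> {True}) \<le> card Q" using that(2) by (intro card_mono) auto
      then show ?thesis by (simp add: card_cartesian_product)
    qed
    have "card S = card T" using card_eq_if_iso[OF f SV] .
    then consider "\<forall>i\<in>Z. (i, True) \<notin> S" "\<forall>i\<in>Z. (i, True) \<notin> T"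
      | "\<forall>i\<in>Z. (i, True) \<in> S" "\<forall>i\<in>Z. (i, True) \<in> T"
      using aonS aonT small large S by (metis not_le)
    then show ?thesis
    proof cases
      case 1
      then show ?thesis using iso_without_reflections[OF f] none S by blast
    next
      case 2
      have "W - S \<subseteq> U \<times> {False}" "W - T \<subseteq> U \<times> {False}"
        using none[of "W - S"] none[of "W - T"] 2 by blast+
      then obtain u b where ub: "u \<in> U" "b \<in> Z" "aff u b ` (W - S) = W - T"
        using iso_without_reflections[OF isos_complement[OF f S]] by blast
      have "inj (aff u b)" using permutes_inj[OF aff_permutes[OF ub(1)]] .
      have "aff u b ` S = aff u b ` (W - (W - S))" using S by (simp add: double_diff)
      also have "\<dots> = W - (W - T)"
        using \<open>inj (aff u b)\<close> by (simp only: image_set_diff ub(3) aff_image_W[OF ub(1)])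
      also have "\<dots> = T" using S by (simp add: double_diff)
      finally show ?thesis using ub by blast
    qed
  qed
qed

section \<open>Counting invariant connection sets\<close>

lemma mult_in_U:
  assumes "u \<in> U" "v \<in> U"
  shows "u * v mod P \<in> U"
proof -
  have "\<not> P dvd u * v"
    using assms U_not_dvd prime prime_dvd_mult_iff[of P u v] by simp
  then have "u * v mod P \<noteq> 0" by (simp add: dvd_eq_mod_eq_0)
  then show ?thesis
    using mod_P_bounds[of "u * v"] unfolding atLeastLessThan_iff by linarith
qed

text \<open>The multiplication law of the semidirect product of the residues by
  \<open>U\<close>.\<close>

lemma aff_comp: "aff u b \<circ> aff v c = aff (u * v mod P) ((u * c + b) mod P)"
proof
  fix x :: "int \<times> bool"
  show "(aff u b \<circ> aff v c) x = aff (u * v mod P) ((u * c + b) mod P) x"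
  proof (cases "x \<in> V")
    case True
    obtain i s where x: "x = (i, s)" by (cases x)
    have "(u * ((v * i + c) mod P) + b) mod P = (u * (v * i + c) + b) mod P"
      by (rule mod_mult_add_right)
    also have "\<dots> = ((u * v) * i + (u * c + b)) mod P"
      by (simp add: algebra_simps)
    also have "\<dots> = (((u * v) mod P) * i + (u * c + b)) mod P"
      by (rule mod_mult_add_left[symmetric])
    also have "\<dots> = (((u * v) mod P) * i + (u * c + b) mod P) mod P"
      by (rule mod_add_right_eq[symmetric])
    finally have 1: "(u * ((v * i + c) mod P) + b) mod P = (((u * v) mod P) * i + (u * c + b) mod P) mod P" .
    have 2: "u * (v * i mod P) mod P = (u * v) mod P * i mod P"
      by (simp add: mod_simps mult.assoc)
    show ?thesis using True 1 2 x by (auto simp: aff_def)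
  next
    case False
    then show ?thesis by (simp add: aff_def)
  qed
qed

lemma aff_1_0: "aff 1 0 = id"
  by (auto simp: aff_def fun_eq_iff)

text \<open>The automorphism group of the dihedral group in coordinates.\<close>

definition affs where "affs = (\<lambda>(u, b). aff u b) ` (U \<times> Z)"

lemma inj_on_aff: "inj_on (\<lambda>(u, b). aff u b) (U \<times> Z)"
proof (rule inj_onI, clarsimp)
  fix u b v c assume ub: "1 \<le> u" "u < P" "0 \<le> b" "b < P" "1 \<le> v" "v < P" "0 \<le> c" "c < P"
    and eq: "aff u b = aff v c"
  \<comment> \<open>The parameters are read off from the images of \<open>\<tau>\<close> and
    \<open>\<sigma>\<close>.\<close>
  have "aff u b (1, False) = aff v c (1, False)" "aff u b (0, True) = aff v c (0, True)"
    using eq by simp_all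
  then show "u = v \<and> b = c" using ub p_gt_2 by (simp add: aff_def)
qed

lemma card_U: "card U = p - 1"
  by simp

lemma affs_iff: "f \<in> affs \<longleftrightarrow> (\<exists>u\<in>U. \<exists>b\<in>Z. f = aff u b)"
  by (auto simp: affs_def)

lemma card_affs: "card affs = (p - 1) * p"
  unfolding affs_def card_image[OF inj_on_aff] card_cartesian_product card_U by simp

lemma affs_comp:
  assumes "f \<in> affs" "g \<in> affs"
  shows "f \<circ> g \<in> affs"
proof -
  obtain u b v c where uv: "u \<in> U" "v \<in> U" and "f = aff u b" "g = aff v c"
    using assms unfolding affs_iff by blast
  then have "f \<circ> g = aff (u * v mod P) ((u * c + b) mod P)" by (simp only: aff_comp)
  moreover have "(u * c + b) mod P \<in> Z" by simp
  ultimately show ?thesis unfolding affs_iff using mult_in_U[OF uv] by blast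
qed

lemma id_in_affs: "id \<in> affs"
  unfolding affs_def using p_gt_2 by (intro image_eqI[of _ _ "(1, 0)"]) (auto simp: aff_1_0)

lemma affs_inv:
  assumes "f \<in> affs"
  shows "Hilbert_Choice.inv f \<in> affs"
proof -
  obtain u b where u: "u \<in> U" "b \<in> Z" "f = aff u b"
    using assms by (auto simp: affs_def)
  obtain v where v: "v \<in> Z" "(u * v) mod P = 1 mod P"
    using linear_solve[OF U_not_dvd[OF u(1)]] by blast
  have 1: "1 mod P = 1" using p_gt_2 by simp
  have "v \<noteq> 0" using v(2) 1 by auto
  then have vU: "v \<in> U" using v(1) by auto
  \<comment> \<open>Chosen to make the shift \<open>v * b + c\<close> of the composite with
    \<open>f\<close> vanish.\<close>
  define c where "c = (- (v * b)) mod P"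
  have "aff v c \<circ> f = id"
  proof -
    have "(v * b + c) mod P = 0" by (simp add: c_def mod_simps)
    then show ?thesis
      using v(2) 1 by (simp add: u(3) aff_comp mult.commute aff_1_0)
  qed
  moreover have "bij f" using permutes_bij[OF aff_permutes[OF u(1)]] u(3) by simp
  ultimately have "Hilbert_Choice.inv f = aff v c"
    by (metis bij_is_surj comp_assoc comp_id id_comp surj_iff)
  then show ?thesis using vU by (auto simp: affs_def c_def intro!: image_eqI[of _ _ "(v, c)"])
qed

section \<open>Connection sets fixed by a single automorphism\<close>

text \<open>The invariant sets are the unions of cosets of the subgroup generated by
  \<open>u\<close> in \<open>U\<close>, and every coset has \<open>ord p (nat u)\<close>
  elements.\<close>

lemma card_invariant_subsets_mult:
  assumes u: "u \<in> U"
  shows "card (invariant_subsets (\<lambda>x. u * x mod P) U) = 2 ^ ((p - 1) div ord p (nat u))"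
proof -
  define d where "d = ord p (nat u)"
  define r where "r = {(x, y). x \<in> U \<and> y \<in> U \<and> (\<exists>k. y = u ^ k * x mod P)}"
  have cop: "coprime p (nat u)"
    using u prime by (intro prime_imp_coprime) (auto dest: dvd_imp_le)
  have d: "d > 0" using cop by (simp add: d_def)
  have pow_eq: "[u ^ k = u ^ l] (mod P) \<longleftrightarrow> [k = l] (mod d)" for k l
  proof -
    have "[u ^ k = u ^ l] (mod P) \<longleftrightarrow> [nat u ^ k = nat u ^ l] (mod p)"
      using u cong_int_iff[of "nat u ^ k" "nat u ^ l" p] by simp
    then show ?thesis using order_divides_expdiff[OF cop] by (simp add: d_def)
  qed
  have cancel: "[a * x = b * x] (mod P) \<longleftrightarrow> [a = b] (mod P)" if "x \<in> U" for a b x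
  proof -
    have "coprime x P"
      using U_not_dvd[OF that] prime by (metis coprime_commute prime_imp_coprime prime_nat_int_transfer)
    then show ?thesis by (simp add: cong_mult_rcancel)
  qed
  have powU: "u ^ k * x mod P \<in> U" if "x \<in> U" for k x
  proof (induction k)
    case 0
    then show ?case using that by simp
  next
    case (Suc k)
    then have "u * (u ^ k * x mod P) mod P \<in> U" using mult_in_U[OF u] by blast
    then show ?case by (simp add: mod_simps mult.assoc)
  qed
  have pow_pow: "u ^ k * (u ^ l * x mod P) mod P = u ^ (k + l) * x mod P" for k l x
    by (simp add: mod_simps power_add mult.assoc)
  have eq: "equiv U r"
  proof (rule equivI)
    show "r \<subseteq> U \<times> U" by (auto simp: r_def)
    show "refl_on U r" by (auto simp: r_def refl_on_def intro!: exI[of _ 0])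
    show "sym r"
    proof (rule symI)
      fix x y assume "(x, y) \<in> r"
      then obtain k where xy: "x \<in> U" "y \<in> U" and k: "y = u ^ k * x mod P" by (auto simp: r_def)
      \<comment> \<open>With natural exponents, \<open>u^(k * (d - 1))\<close> plays the part of the
        inverse of \<open>u^k\<close>.\<close>
      have "k * (d - 1) + k = k * d" using d by (cases d) simp_all
      then have "[u ^ (k * (d - 1) + k) = u ^ 0] (mod P)"
        unfolding pow_eq by (simp add: cong_def)
      then have "[u ^ (k * (d - 1) + k) * x = u ^ 0 * x] (mod P)"
        by (rule cong_mult[OF _ cong_refl])
      then have "x = u ^ (k * (d - 1)) * y mod P"
        unfolding k pow_pow using xy by (simp add: cong_def)
      then show "(y, x) \<in> r" using xy by (auto simp: r_def)
    qed
    show "trans r"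
    proof (rule transI)
      fix x y z assume "(x, y) \<in> r" "(y, z) \<in> r"
      then obtain k l where "x \<in> U" "z \<in> U" "y = u ^ k * x mod P" "z = u ^ l * y mod P"
        by (auto simp: r_def)
      then show "(x, z) \<in> r" using pow_pow unfolding r_def by auto
    qed
  qed
  have "card C = d" if "C \<in> U // r" for C
  proof -
    from that obtain x where x: "x \<in> U" "C = r `` {x}" by (rule quotientE)
    have mod_d: "u ^ k * x mod P = u ^ (k mod d) * x mod P" for k
      using pow_eq[of k "k mod d"] cong_mult[of "u ^ k" "u ^ (k mod d)" P x x]
      by (simp add: cong_def)
    have "C = (\<lambda>k. u ^ k * x mod P) ` {..<d}"
    proof
      show "C \<subseteq> (\<lambda>k. u ^ k * x mod P) ` {..<d}"
      proof
        fix y assume "y \<in> C"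
        then obtain k where "y = u ^ k * x mod P" by (auto simp: x r_def)
        then show "y \<in> (\<lambda>k. u ^ k * x mod P) ` {..<d}"
          using mod_d[of k] d by (intro image_eqI[of _ _ "k mod d"]) auto
      qed
      show "(\<lambda>k. u ^ k * x mod P) ` {..<d} \<subseteq> C"
        using powU[OF x(1)] x by (auto simp: r_def)
    qed
    moreover have "inj_on (\<lambda>k. u ^ k * x mod P) {..<d}"
    proof (rule inj_onI)
      fix k l assume kl: "k \<in> {..<d}" "l \<in> {..<d}" "u ^ k * x mod P = u ^ l * x mod P"
      then have "[k = l] (mod d)" using cancel[OF x(1)] pow_eq by (simp add: cong_def)
      then show "k = l" using kl by (simp add: cong_def)
    qed
    ultimately show ?thesis by (simp add: card_image)
  qed
  then have "d * card (U // r) = card (\<Union>(U // r))"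
    using eq quotient_disj[OF eq]
    by (intro card_partition) (auto simp: Union_quotient[OF eq] equiv_def intro!: finite_quotient)
  also have "\<dots> = p - 1" by (simp only: Union_quotient[OF eq] card_U)
  finally have "card (U // r) = (p - 1) div d" using d by (metis nonzero_mult_div_cancel_left not_less0)
  moreover have "invariant_subsets (\<lambda>x. u * x mod P) U = {S. S \<subseteq> U \<and> r `` S \<subseteq> S}"
  proof (intro subset_antisym subsetI)
    fix S assume "S \<in> invariant_subsets (\<lambda>x. u * x mod P) U"
    then have S: "S \<subseteq> U" "(\<lambda>x. u * x mod P) ` S = S" by (auto simp: invariant_subsets_def)
    have "u ^ k * x mod P \<in> S" if "x \<in> S" for k x
    proof (induction k)
      case 0
      then show ?case using that S(1) by auto
    next
      case (Suc k)
      then have "u * (u ^ k * x mod P) mod P \<in> S" using S(2) by blast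
      then show ?case by (simp add: mod_simps mult.assoc)
    qed
    then show "S \<in> {S. S \<subseteq> U \<and> r `` S \<subseteq> S}" using S(1) by (auto simp: r_def)
  next
    fix S assume "S \<in> {S. S \<subseteq> U \<and> r `` S \<subseteq> S}"
    then have S: "S \<subseteq> U" "r `` S \<subseteq> S" by auto
    have "(\<lambda>x. u * x mod P) ` S \<subseteq> S"
    proof clarify
      fix x assume x: "x \<in> S"
      then have xU: "x \<in> U" using S(1) by blast
      have "(x, u * x mod P) \<in> r"
        unfolding r_def using xU mult_in_U[OF u xU] by (auto intro!: exI[of _ 1])
      then show "u * x mod P \<in> S" using S(2) x by blast
    qed
    moreover have "inj_on (\<lambda>x. u * x mod P) S"
    proof (rule inj_onI)
      fix x y assume "x \<in> S" "y \<in> S" "u * x mod P = u * y mod P"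
      moreover from this have "x \<in> Z" "y \<in> Z" using S(1) by auto
      ultimately show "x = y"
        using linear_cancel[OF U_not_dvd[OF u], of x y 0] by simp
    qed
    moreover have "finite S" using S(1) by (rule finite_subset) simp
    ultimately show "S \<in> invariant_subsets (\<lambda>x. u * x mod P) U"
      using S(1) by (simp add: invariant_subsets_def endo_inj_surj)
  qed
  ultimately show ?thesis
    using card_saturated_subsets[OF _ eq] by (simp add: d_def)
qed

abbreviation mult_inv :: "int \<Rightarrow> nat" where
  "mult_inv u \<equiv> card (invariant_subsets (\<lambda>x. u * x mod P) U)"

abbreviation affine_inv :: "int \<Rightarrow> int \<Rightarrow> nat" where
  "affine_inv u b \<equiv> card (invariant_subsets (\<lambda>x. (u * x + b) mod P) Z)"

text \<open>The map acts separately on the nontrivial powers of \<open>\<tau>\<close>, as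
  multiplication by \<open>u\<close>, and on the reflections, as
  \<open>x -> u x + b\<close>.\<close>

lemma card_invariant_subsets_aff:
  assumes u: "u \<in> U"
  shows "card (invariant_subsets (aff u b) W) = mult_inv u * affine_inv u b"
proof -
  have W: "W = U \<times> {False} \<union> Z \<times> {True}" by force
  have aff_U: "aff u b (i, False) = (u * i mod P, False)" if "i \<in> U" for i
    using that by (simp add: aff_def)
  have aff_Z: "aff u b (i, True) = ((u * i + b) mod P, True)" if "i \<in> Z" for i
    using that by (simp add: aff_def)
  have "card (invariant_subsets (aff u b) W)
      = card (invariant_subsets (aff u b) (U \<times> {False})) * card (invariant_subsets (aff u b) (Z \<times> {True}))"
    unfolding W
  proof (rule card_invariant_subsets_Un)
    show "aff u b ` (U \<times> {False}) \<subseteq> U \<times> {False}"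
    proof (rule image_subsetI)
      fix x assume "x \<in> U \<times> {False}"
      then obtain i where i: "i \<in> U" "x = (i, False)" by blast
      then show "aff u b x \<in> U \<times> {False}" using aff_U[OF i(1)] mult_in_U[OF u i(1)] by simp
    qed
    show "aff u b ` (Z \<times> {True}) \<subseteq> Z \<times> {True}"
    proof (rule image_subsetI)
      fix x assume "x \<in> Z \<times> {True}"
      then obtain i where "i \<in> Z" "x = (i, True)" by blast
      then show "aff u b x \<in> Z \<times> {True}" using aff_Z by simp
    qed
  qed auto
  also have "card (invariant_subsets (aff u b) (U \<times> {False})) = mult_inv u"
  proof (rule card_invariant_subsets_conj[symmetric])
    show "bij_betw (\<lambda>i. (i, False)) U (U \<times> {False})"
      by (auto simp: bij_betw_def inj_on_def)
  qed (use aff_U mult_in_U[OF u] in blast)+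
  also have "card (invariant_subsets (aff u b) (Z \<times> {True})) = affine_inv u b"
  proof (rule card_invariant_subsets_conj[symmetric])
    show "bij_betw (\<lambda>i. (i, True)) Z (Z \<times> {True})"
      by (auto simp: bij_betw_def inj_on_def)
    show "(u * x + b) mod P \<in> Z" for x by simp
  qed (rule aff_Z)
  finally show ?thesis .
qed

text \<open>The fixed point \<open>0\<close> may be added to an invariant subset of \<open>U\<close>
  or not.\<close>

lemma affine_inv_0:
  assumes u: "u \<in> U"
  shows "affine_inv u 0 = 2 * mult_inv u"
proof -
  have Z: "Z = {0} \<union> U" using P_pos by auto
  have "affine_inv u 0 = card (invariant_subsets (\<lambda>x. u * x mod P) ({0} \<union> U))"
    by (simp add: Z)
  also have "\<dots> = card (invariant_subsets (\<lambda>x. u * x mod P) {0}) * mult_inv u"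
  proof (rule card_invariant_subsets_Un)
    show "(\<lambda>x. u * x mod P) ` U \<subseteq> U" using mult_in_U[OF u] by blast
  qed simp_all
  also have "card (invariant_subsets (\<lambda>x. u * x mod P) {0}) = 2"
    by (subst card_invariant_subsets_id) simp_all
  finally show ?thesis .
qed

text \<open>For \<open>u\<close> other than \<open>1\<close> the map \<open>x -> u x + b\<close> has
  the fixed point \<open>e = b / (1 - u)\<close>, and translation by \<open>e\<close> conjugates it
  to \<open>x -> u x\<close>.\<close>

lemma affine_inv_neq_1:
  assumes u: "u \<in> U" "u \<noteq> 1" and b: "b \<in> Z"
  shows "affine_inv u b = 2 * mult_inv u"
proof -
  have "\<not> P dvd 1 - u"
    using u by (auto dest: zdvd_imp_le simp: dvd_diff_commute[of P 1 u])
  then obtain e where e: "e \<in> Z" "((1 - u) * e) mod P = b mod P"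
    using linear_solve by blast
  have fix_e: "(u * (x + e) + b) mod P = (u * x + e) mod P" for x
  proof -
    have "[(1 - u) * e = b] (mod P)" using e(2) by (simp add: cong_def)
    then have "[u * x + u * e + (1 - u) * e = u * x + u * e + b] (mod P)"
      by (rule cong_add[OF cong_refl])
    then show ?thesis by (simp add: cong_def algebra_simps)
  qed
  have "affine_inv u 0 = affine_inv u b"
  proof (rule card_invariant_subsets_conj[where \<phi> = "\<lambda>x. (x + e) mod P"])
    have "inj_on (\<lambda>x. (x + e) mod P) Z"
    proof (rule inj_onI)
      fix x y assume "x \<in> Z" "y \<in> Z" "(x + e) mod P = (y + e) mod P"
      then show "x = y" using linear_cancel[of 1 x y e] p_gt_2 by simp
    qed
    moreover have "(\<lambda>x. (x + e) mod P) ` Z \<subseteq> Z" by auto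
    ultimately show "bij_betw (\<lambda>x. (x + e) mod P) Z Z"
      by (auto simp: bij_betw_def endo_inj_surj)
    show "(u * ((x + e) mod P) + b) mod P = ((u * x + 0) mod P + e) mod P" for x
      using fix_e[of x] by (simp add: mod_mult_add_right mod_simps)
  qed simp
  then show ?thesis using affine_inv_0[OF u(1)] by simp
qed

lemma mult_inv_1: "mult_inv 1 = 2 ^ (p - 1)"
  by (subst card_invariant_subsets_id) auto

lemma affine_inv_1_0: "affine_inv 1 0 = 2 ^ p"
  by (subst card_invariant_subsets_id) auto

text \<open>A nonzero translation permutes the residues in a single cycle.\<close>

lemma affine_inv_translation:
  assumes b: "b \<in> U"
  shows "affine_inv 1 b = 2"
proof -
  let ?f = "\<lambda>x. (1 * x + b) mod P"
  have inj: "inj_on ?f Z"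
  proof (rule inj_onI)
    fix x y assume "x \<in> Z" "y \<in> Z" "?f x = ?f y"
    then show "x = y" using linear_cancel[of 1 x y b] p_gt_2 by simp
  qed
  have surj: "?f ` Z = Z"
    using inj by (intro endo_inj_surj) auto
  have "invariant_subsets ?f Z = {{}, Z}"
  proof
    show "invariant_subsets ?f Z \<subseteq> {{}, Z}"
    proof
      fix S assume "S \<in> invariant_subsets ?f Z"
      then have S: "S \<subseteq> Z" "?f ` S = S" by (auto simp: invariant_subsets_def)
      have "j \<in> S \<longleftrightarrow> (j + b) mod P \<in> S" if j: "j \<in> Z" for j
      proof -
        have "j \<in> S \<longleftrightarrow> ?f j \<in> ?f ` S" using inj_on_image_mem_iff[OF inj j S(1)] by simp
        then show ?thesis by (simp only: S(2)) simp
      qed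
      from shift_invariant_trivial[OF U_not_dvd[OF b] S(1) this] show "S \<in> {{}, Z}" by blast
    qed
    show "{{}, Z} \<subseteq> invariant_subsets ?f Z"
      using surj by (simp add: invariant_subsets_def)
  qed
  moreover have "Z \<noteq> {}" using P_pos by simp
  ultimately show ?thesis by (simp only:) simp
qed

section \<open>Summation over the automorphism group\<close>

text \<open>The terms are grouped by multiplicative order: modulo a prime there are exactly
  \<open>totient d\<close> residues of order \<open>d\<close> for each divisor \<open>d\<close> of
  \<open>p - 1\<close>.\<close>

lemma sum_mult_inv:
  "(\<Sum>u\<in>U. mult_inv u ^ 2) = (\<Sum>d | d dvd p - 1. totient d * 2 ^ (2 * (p - 1) div d))"
proof -
  have p1: "p - 1 > 0" using p_gt_2 by simp
  have tot: "totatives p = {1..<p}"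
    unfolding totatives_prime[OF prime] by auto
  have U: "U = int ` {1..<p}"
    by (simp add: image_int_atLeastLessThan)
  have "(\<Sum>u\<in>U. mult_inv u ^ 2) = (\<Sum>u\<in>U. (2 ^ ((p - 1) div ord p (nat u))) ^ 2)"
    by (rule sum.cong[OF refl]) (simp only: card_invariant_subsets_mult)
  also have "\<dots> = (\<Sum>v\<in>totatives p. (2 ^ ((p - 1) div ord p v)) ^ 2)"
    unfolding U tot by (subst sum.reindex) (auto simp: inj_on_def)
  also have "\<dots> = (\<Sum>d | d dvd p - 1. \<Sum>v | v \<in> totatives p \<and> ord p v = d. (2 ^ ((p - 1) div ord p v)) ^ 2)"
  proof (rule sum.group[symmetric])
    show "ord p ` totatives p \<subseteq> {d. d dvd p - 1}"
    proof clarify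
      fix v assume "v \<in> totatives p"
      then have "coprime p v" by (simp add: totatives_def coprime_commute)
      then show "ord p v dvd p - 1"
        using order_divides_totient[of p v] totient_prime[OF prime] by simp
    qed
  qed (use p1 in auto)
  also have "\<dots> = (\<Sum>d | d dvd p - 1. totient d * 2 ^ (2 * (p - 1) div d))"
  proof (rule sum.cong[OF refl])
    fix d assume d: "d \<in> {d. d dvd p - 1}"
    then have "2 * (p - 1) div d = ((p - 1) div d) * 2"
      by (simp add: div_mult_swap mult.commute)
    moreover have "card {v \<in> totatives p. ord p v = d} = totient d"
      using prime_card_elements_with_ord_eq_totient[OF _ prime, of d] d p_gt_2 by simp
    ultimately show "(\<Sum>v | v \<in> totatives p \<and> ord p v = d. (2 ^ ((p - 1) div ord p v)) ^ 2)
        = totient d * 2 ^ (2 * (p - 1) div d)"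
      by (simp add: power_mult)
  qed
  finally show ?thesis .
qed

text \<open>Each \<open>u\<close> other than \<open>1\<close> contributes
  \<open>2 * p * mult_inv u ^ 2\<close>. The extra summand on the left is this expression at
  \<open>u = 1\<close>; it completes the sum over \<open>U\<close> without subtraction on natural
  numbers.\<close>

lemma sum_card_invariant_subsets_aff:
  "(\<Sum>u\<in>U. \<Sum>b\<in>Z. card (invariant_subsets (aff u b) W)) + 2 * p * 2 ^ (2 * (p - 1))
    = 2 * p * (\<Sum>d | d dvd p - 1. totient d * 2 ^ (2 * (p - 1) div d))
      + 2 ^ (p - 1) * (2 ^ p + 2 * (p - 1))"
proof -
  define F where "F u = (\<Sum>b\<in>Z. mult_inv u * affine_inv u b)" for u
  have 1: "1 \<in> U" using p_gt_2 by simp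
  have F_other: "F u = 2 * p * mult_inv u ^ 2" if "u \<in> U" "u \<noteq> 1" for u
  proof -
    have "F u = (\<Sum>b\<in>Z. mult_inv u * (2 * mult_inv u))"
      unfolding F_def by (rule sum.cong[OF refl]) (simp only: affine_inv_neq_1[OF that])
    then show ?thesis by (simp add: power2_eq_square)
  qed
  have F_1: "F 1 = 2 ^ (p - 1) * (2 ^ p + 2 * (p - 1))"
  proof -
    have Z: "Z = insert 0 U" using P_pos by auto
    have "F 1 = 2 ^ (p - 1) * (\<Sum>b\<in>Z. affine_inv 1 b)"
      unfolding F_def mult_inv_1 by (rule sum_distrib_left[symmetric])
    also have "(\<Sum>b\<in>Z. affine_inv 1 b) = (\<Sum>b\<in>insert 0 U. affine_inv 1 b)"
      by (rule arg_cong[OF Z])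
    also have "\<dots> = affine_inv 1 0 + (\<Sum>b\<in>U. affine_inv 1 b)"
      by (rule sum.insert) auto
    also have "(\<Sum>b\<in>U. affine_inv 1 b) = (\<Sum>b\<in>U. 2)"
      by (rule sum.cong[OF refl]) (simp only: affine_inv_translation)
    also have "\<dots> = 2 * (p - 1)" using card_U by simp
    finally show ?thesis by (simp only: affine_inv_1_0)
  qed
  have "(\<Sum>u\<in>U. \<Sum>b\<in>Z. card (invariant_subsets (aff u b) W)) = (\<Sum>u\<in>U. F u)"
    unfolding F_def by (intro sum.cong[OF refl]) (simp only: card_invariant_subsets_aff)
  also have "\<dots> = F 1 + (\<Sum>u\<in>U - {1}. F u)"
    using 1 by (intro sum.remove) auto
  also have "(\<Sum>u\<in>U - {1}. F u) = (\<Sum>u\<in>U - {1}. 2 * p * mult_inv u ^ 2)"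
    by (rule sum.cong[OF refl]) (simp add: F_other)
  finally have "(\<Sum>u\<in>U. \<Sum>b\<in>Z. card (invariant_subsets (aff u b) W)) + 2 * p * mult_inv 1 ^ 2
      = F 1 + (\<Sum>u\<in>U. 2 * p * mult_inv u ^ 2)"
    using sum.remove[of U 1 "\<lambda>u. 2 * p * mult_inv u ^ 2"] 1 by simp
  also have "(\<Sum>u\<in>U. 2 * p * mult_inv u ^ 2) = 2 * p * (\<Sum>u\<in>U. mult_inv u ^ 2)"
    by (rule sum_distrib_left[symmetric])
  finally show ?thesis
    by (simp only: F_1 sum_mult_inv mult_inv_1 power_mult[symmetric] mult.commute[of "p - 1" 2] add.commute)
qed

lemma bex_affs: "(\<exists>h\<in>affs. Q h) \<longleftrightarrow> (\<exists>u\<in>U. \<exists>b\<in>Z. Q (aff u b))"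
  unfolding affs_iff Bex_def by blast

text \<open>By \<open>iso_iff_aff_image\<close> the isomorphism relation is the orbit relation of
  \<open>affs\<close> on the subsets of \<open>W\<close>, to which Burnside's lemma applies.\<close>

lemma card_orbits:
  "p * (p - 1) * card (Pow W // {(S, T). S \<in> Pow W \<and> T \<in> Pow W \<and> isos S T \<noteq> {}})
      + 2 * p * 2 ^ (2 * (p - 1))
    = 2 * p * (\<Sum>d | d dvd p - 1. totient d * 2 ^ (2 * (p - 1) div d))
      + 2 ^ (p - 1) * (2 ^ p + 2 * (p - 1))"
proof -
  have eq: "isos S T \<noteq> {} \<longleftrightarrow> (\<exists>h\<in>affs. h ` S = T)" if "S \<in> Pow W" "T \<in> Pow W" for S T
    unfolding bex_affs by (rule iso_iff_aff_image) (use that in \<open>simp_all only: Pow_iff\<close>)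
  have "{(S, T). S \<in> Pow W \<and> T \<in> Pow W \<and> isos S T \<noteq> {}}
      = {(S, T). S \<in> Pow W \<and> T \<in> Pow W \<and> (\<exists>h\<in>affs. h ` S = T)}"
    by (intro arg_cong[of _ _ Collect] arg_cong[of _ _ case_prod] ext conj_cong refl eq)
  moreover have "(\<Sum>h\<in>affs. card {S \<in> Pow W. h ` S = S})
      = card affs * card (Pow W // {(S, T). S \<in> Pow W \<and> T \<in> Pow W \<and> (\<exists>h\<in>affs. h ` S = T)})"
  proof (rule burnside_sets)
    show "finite affs" by (simp add: affs_def)
    show "bij h" if "h \<in> affs" for h
      using that permutes_bij[OF aff_permutes] unfolding affs_iff by blast
    show "h ` S \<in> Pow W" if h: "h \<in> affs" and S: "S \<in> Pow W" for h S
    proof -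
      obtain u b where "u \<in> U" "h = aff u b" using h unfolding affs_iff by blast
      then have "h ` W = W" using aff_image_W by simp
      then show ?thesis using S image_mono[of S W h] by blast
    qed
  qed (use id_in_affs affs_comp affs_inv in \<open>simp_all\<close>)
  moreover have "(\<Sum>h\<in>affs. card {S \<in> Pow W. h ` S = S})
      = (\<Sum>u\<in>U. \<Sum>b\<in>Z. card (invariant_subsets (aff u b) W))"
    unfolding affs_def
    by (subst sum.reindex[OF inj_on_aff])
      (simp add: sum.cartesian_product invariant_subsets_def case_prod_beta)
  ultimately show ?thesis
    using sum_card_invariant_subsets_aff card_affs by (simp only: mult.commute[of p "p - 1"])
qed

end

section \<open>From the dihedral group to coordinates\<close>

lemma card_quotient_bij_betw:
  assumes F: "bij_betw F X Y" and r: "r \<subseteq> X \<times> X" and s: "s \<subseteq> Y \<times> Y"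
    and rs: "\<And>x y. x \<in> X \<Longrightarrow> y \<in> X \<Longrightarrow> (x, y) \<in> r \<longleftrightarrow> (F x, F y) \<in> s"
  shows "card (X // r) = card (Y // s)"
proof (rule bij_betw_same_card)
  have inj: "inj_on F X" and im: "F ` X = Y" using F by (auto simp: bij_betw_def)
  have cls: "F ` (r `` {x}) = s `` {F x}" if "x \<in> X" for x
  proof
    show "F ` (r `` {x}) \<subseteq> s `` {F x}" using rs r that by blast
    show "s `` {F x} \<subseteq> F ` (r `` {x})"
    proof
      fix z assume z: "z \<in> s `` {F x}"
      then obtain y where "y \<in> X" "z = F y" using s im by blast
      then show "z \<in> F ` (r `` {x})" using z rs that by blast
    qed
  qed
  show "bij_betw ((`) F) (X // r) (Y // s)"
    unfolding bij_betw_def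
  proof
    have "X // r \<subseteq> Pow X" using r by (auto simp: quotient_def)
    then show "inj_on ((`) F) (X // r)"
      using inj_on_image_Pow[OF inj] inj_on_subset by blast
    have "(`) F ` (X // r) = (\<lambda>x. F ` (r `` {x})) ` X" by (auto simp: quotient_def)
    also have "\<dots> = (\<lambda>x. s `` {F x}) ` X" using cls by (rule image_cong[OF refl])
    also have "\<dots> = Y // s" unfolding im[symmetric] by (auto simp: quotient_def)
    finally show "(`) F ` (X // r) = Y // s" .
  qed
qed

section \<open>Isomorphism of Cayley digraphs as a condition on vertices\<close>

text \<open>A digraph isomorphism carries separate maps on vertices and arcs. In \<open>Cay\<close>
  arcs are pairs with the projections as endpoints, so the vertex map \<open>f\<close> forces the
  arc map to act as \<open>map_prod f f\<close>.\<close>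

lemma digraph_iso_Cay_iff:
  "digraph_iso (Cay G S) (Cay G T) \<longleftrightarrow>
    (\<exists>f. bij_betw f (carrier G) (carrier G) \<and>
      (\<forall>x\<in>carrier G. \<forall>y\<in>carrier G. y \<otimes>\<^bsub>G\<^esub> inv\<^bsub>G\<^esub> x \<in> S \<longleftrightarrow> f y \<otimes>\<^bsub>G\<^esub> inv\<^bsub>G\<^esub> f x \<in> T))"
  (is "?L \<longleftrightarrow> ?R")
proof
  define A where "A Q = {(g, h). g \<in> carrier G \<and> h \<in> carrier G \<and> h \<otimes>\<^bsub>G\<^esub> inv\<^bsub>G\<^esub> g \<in> Q}" for Q
  have Cay: "Cay G Q = \<lparr>verts = carrier G, arcs = A Q, tail = fst, head = snd\<rparr>" for Q
    by (simp add: Cay_def A_def)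
  {
    assume ?L
    then obtain h where h: "pre_digraph.digraph_isomorphism (Cay G S) h" and T: "Cay G T = app_iso h (Cay G S)"
      by (auto simp: digraph_iso_def)
    let ?f = "iso_verts h"
    have inj: "inj_on ?f (carrier G)"
      using h by (simp add: pre_digraph.digraph_isomorphism_def Cay)
    have im: "?f ` carrier G = carrier G" and AT: "A T = iso_arcs h ` A S"
      and ht: "iso_tail h = fst" "iso_head h = snd"
      using T by (simp_all add: Cay app_iso_def)
    have arc: "iso_arcs h a = (?f (fst a), ?f (snd a))" if "a \<in> A S" for a
      using h that ht by (simp add: pre_digraph.digraph_isomorphism_def Cay prod_eq_iff)
    have "y \<otimes>\<^bsub>G\<^esub> inv\<^bsub>G\<^esub> x \<in> S \<longleftrightarrow> ?f y \<otimes>\<^bsub>G\<^esub> inv\<^bsub>G\<^esub> ?f x \<in> T"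
      if xy: "x \<in> carrier G" "y \<in> carrier G" for x y
    proof -
      have fc: "?f x \<in> carrier G" "?f y \<in> carrier G" using im xy by auto
      have "(x, y) \<in> A S \<longleftrightarrow> (?f x, ?f y) \<in> A T"
      proof
        assume "(x, y) \<in> A S"
        then show "(?f x, ?f y) \<in> A T" using arc[of "(x, y)"] AT by force
      next
        assume "(?f x, ?f y) \<in> A T"
        then obtain a where a: "a \<in> A S" "(?f x, ?f y) = iso_arcs h a" using AT by blast
        then have "?f x = ?f (fst a)" "?f y = ?f (snd a)" "fst a \<in> carrier G" "snd a \<in> carrier G"
          using arc[OF a(1)] by (auto simp: A_def)
        then have "a = (x, y)" using inj_onD[OF inj] xy by (metis prod.collapse)
        then show "(x, y) \<in> A S" using a(1) by simp
      qed
      then show ?thesis using xy fc by (simp add: A_def)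
    qed
    then show ?R using inj im by (auto simp: bij_betw_def)
  next
    assume ?R
    then obtain f where f: "bij_betw f (carrier G) (carrier G)"
      and iff: "\<And>x y. x \<in> carrier G \<Longrightarrow> y \<in> carrier G \<Longrightarrow>
        y \<otimes>\<^bsub>G\<^esub> inv\<^bsub>G\<^esub> x \<in> S \<longleftrightarrow> f y \<otimes>\<^bsub>G\<^esub> inv\<^bsub>G\<^esub> f x \<in> T"
      by blast
    have inj: "inj_on f (carrier G)" and im: "f ` carrier G = carrier G"
      using f by (auto simp: bij_betw_def)
    define h where "h = \<lparr>iso_verts = f, iso_arcs = map_prod f f, iso_head = snd, iso_tail = fst\<rparr>"
    have "map_prod f f ` A S = A T"
    proof
      show "map_prod f f ` A S \<subseteq> A T" using iff im by (auto simp: A_def)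
      show "A T \<subseteq> map_prod f f ` A S"
      proof
        fix a assume a: "a \<in> A T"
        obtain g k where gk: "a = (g, k)" by (cases a)
        then have "g \<in> f ` carrier G" "k \<in> f ` carrier G" using a im by (auto simp: A_def)
        then obtain x y where xy: "x \<in> carrier G" "y \<in> carrier G" "g = f x" "k = f y" by blast
        then have "(x, y) \<in> A S" using a gk iff[OF xy(1,2)] by (simp add: A_def)
        then show "a \<in> map_prod f f ` A S" using xy gk by force
      qed
    qed
    then have "Cay G T = app_iso h (Cay G S)"
      by (simp add: Cay app_iso_def h_def im)
    moreover have "pre_digraph.digraph_isomorphism (Cay G S) h"
    proof -
      have "inj_on (map_prod f f) (carrier G \<times> carrier G)"
        using map_prod_inj_on[OF inj inj] .
      then have "inj_on (map_prod f f) (A S)"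
        by (rule inj_on_subset) (auto simp: A_def)
      then show ?thesis
        using inj wf_digraph_Cay[of G S]
        by (simp add: pre_digraph.digraph_isomorphism_def Cay h_def)
    qed
    ultimately show ?L by (auto simp: digraph_iso_def)
  }
qed

text \<open>The connection set is recovered as the set of heads of the arcs leaving the
  identity.\<close>

lemma (in group) inj_on_Cay: "inj_on (Cay G) (Pow (carrier G))"
proof (rule inj_onI)
  fix S T assume S: "S \<in> Pow (carrier G)" "T \<in> Pow (carrier G)" and eq: "Cay G S = Cay G T"
  have "x \<in> Q \<longleftrightarrow> (\<one>, x) \<in> arcs (Cay G Q)" if "x \<in> carrier G" for x Q
    using that by (simp add: Cay_def)
  then show "S = T" using S eq by (metis PowD subsetD subset_antisym subsetI)
qed

section \<open>Normal forms in the dihedral group\<close>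

context dihedral_group
begin

text \<open>Exponents range over all integers, so that products can be computed before reducing
  modulo \<open>n\<close>.\<close>

definition elt :: "int \<times> bool \<Rightarrow> 'a" where
  "elt x = (if snd x then \<sigma> else \<one>) \<otimes> \<tau> [^] fst x"

lemma sigma_sigma: "\<sigma> \<otimes> \<sigma> = \<one>"
  using sigma_pow sigma_closed by (simp add: numeral_2_eq_2)

lemma inv_sigma: "inv \<sigma> = \<sigma>"
  using sigma_sigma sigma_closed by (simp add: inv_equality)

lemma sigma_cancel: "x \<in> carrier G \<Longrightarrow> \<sigma> \<otimes> (\<sigma> \<otimes> x) = x"
  using sigma_sigma sigma_closed by (simp add: m_assoc[symmetric])

lemma sigma_nat_pow: "\<sigma> \<otimes> \<tau> [^] (k::nat) \<otimes> \<sigma> = inv (\<tau> [^] k)"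
proof (induction k)
  case 0
  then show ?case by (simp add: sigma_sigma sigma_closed)
next
  case (Suc k)
  \<comment> \<open>The trivial factor \<open>\<sigma> \<otimes> \<sigma>\<close> is inserted before
    the last \<open>\<tau>\<close>.\<close>
  have "\<sigma> \<otimes> \<tau> [^] Suc k \<otimes> \<sigma> = (\<sigma> \<otimes> \<tau> [^] k \<otimes> \<sigma>) \<otimes> (\<sigma> \<otimes> \<tau> \<otimes> \<sigma>)"
    using sigma_closed tau_closed by (simp add: m_assoc sigma_cancel)
  also have "\<dots> = inv (\<tau> [^] k) \<otimes> inv \<tau>" by (simp only: Suc sigma_tau_sigma)
  also have "\<dots> = inv (\<tau> [^] Suc k)"
    using tau_closed by (metis inv_mult_group nat_pow_closed nat_pow_Suc2)
  finally show ?case .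
qed

lemma sigma_int_pow: "\<sigma> \<otimes> \<tau> [^] (k::int) \<otimes> \<sigma> = \<tau> [^] (- k)"
proof (cases "k \<ge> 0")
  case True
  then show ?thesis
    using sigma_nat_pow[of "nat k"] tau_closed by (simp add: int_pow_neg flip: int_pow_int)
next
  case False
  define m where "m = nat (- k)"
  have k: "k = - int m" using False by (simp add: m_def)
  have "\<sigma> \<otimes> inv (\<tau> [^] m) \<otimes> \<sigma> = inv (\<sigma> \<otimes> \<tau> [^] m \<otimes> \<sigma>)"
    using sigma_closed tau_closed by (simp add: inv_mult_group inv_sigma m_assoc)
  then show ?thesis
    using tau_closed by (simp add: k int_pow_neg int_pow_int sigma_nat_pow)
qed

lemma elt_closed: "elt x \<in> carrier G"
  using tau_closed sigma_closed by (simp add: elt_def)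

text \<open>Moving \<open>\<sigma>\<close> past a power of \<open>\<tau>\<close> inverts the power.
  Up to reduction modulo \<open>n\<close>, this is the pair that \<open>adj\<close> tests.\<close>

lemma elt_quotient:
  "elt y \<otimes> inv (elt x) = elt (if snd x then fst x - fst y else fst y - fst x, snd x \<noteq> snd y)"
proof -
  obtain i s j t where x: "x = (i, s)" and y: "y = (j, t)" by (cases x, cases y)
  have pow: "\<tau> [^] j \<otimes> inv (\<tau> [^] i) = \<tau> [^] (j - i)"
    using tau_closed by (simp add: int_pow_diff)
  have swap: "\<tau> [^] (j - i) \<otimes> \<sigma> = \<sigma> \<otimes> \<tau> [^] (i - j)"
    using arg_cong[OF sigma_int_pow[of "j - i"], of "\<lambda>z. \<sigma> \<otimes> z"] tau_closed sigma_closed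
    by (simp add: m_assoc sigma_cancel)
  show ?thesis
  proof (cases s)
    case True
    have "\<tau> [^] j \<otimes> inv (\<sigma> \<otimes> \<tau> [^] i) = \<tau> [^] (j - i) \<otimes> \<sigma>"
      using tau_closed sigma_closed by (simp add: inv_mult_group inv_sigma pow flip: m_assoc)
    also note swap
    finally have 1: "\<tau> [^] j \<otimes> inv (\<sigma> \<otimes> \<tau> [^] i) = \<sigma> \<otimes> \<tau> [^] (i - j)" .
    then have "\<sigma> \<otimes> \<tau> [^] j \<otimes> inv (\<sigma> \<otimes> \<tau> [^] i) = \<tau> [^] (i - j)"
      using tau_closed sigma_closed by (simp add: m_assoc sigma_cancel)
    then show ?thesis
      using True 1 tau_closed sigma_closed by (cases t) (simp_all add: x y elt_def)
  next
    case False
    then show ?thesis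
      using tau_closed sigma_closed by (cases t) (simp_all add: x y elt_def pow m_assoc)
  qed
qed

lemma elt_mod: "elt (i mod int n, s) = elt (i, s)"
proof -
  have "\<tau> [^] (int n * (i div int n)) = \<one>"
    using tau_closed tau_pow by (simp add: int_pow_int flip: int_pow_pow)
  then have "\<tau> [^] i = \<tau> [^] (i mod int n)"
    using tau_closed int_pow_mult[of \<tau> "int n * (i div int n)" "i mod int n"] by simp
  then show ?thesis by (simp add: elt_def)
qed

text \<open>By \<open>elt_quotient\<close> the range is closed under \<open>a b^-1\<close>, hence a
  subgroup, and it contains both generators.\<close>

lemma range_elt: "range elt = carrier G"
proof -
  have one: "elt (0, False) = \<one>" by (simp add: elt_def)
  have quot: "\<exists>z. elt y \<otimes> inv (elt x) = elt z" for x y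
    using elt_quotient by blast
  have "subgroup (range elt) G"
  proof (rule subgroupI)
    show "range elt \<subseteq> carrier G" using elt_closed by blast
    show inv: "inv a \<in> range elt" if "a \<in> range elt" for a
    proof -
      from that obtain x where x: "a = elt x" by blast
      obtain z where "elt (0, False) \<otimes> inv (elt x) = elt z" using quot by blast
      then have "inv a = elt z" using x one elt_closed by simp
      then show ?thesis by blast
    qed
    show "a \<otimes> b \<in> range elt" if ab: "a \<in> range elt" "b \<in> range elt" for a b
    proof -
      obtain x y where x: "a = elt x" "inv b = elt y" using ab inv[OF ab(2)] by blast
      have "b \<in> carrier G" using ab(2) elt_closed by blast
      then have "a \<otimes> b = elt x \<otimes> inv (elt y)" by (simp flip: x)
      then show ?thesis using quot[of x y] by (metis rangeI)
    qed
  qed auto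
  moreover have "{\<tau>, \<sigma>} \<subseteq> range elt"
  proof -
    have "\<tau> = elt (1, False)" "\<sigma> = elt (0, True)"
      using tau_closed sigma_closed by (simp_all add: elt_def)
    then show ?thesis by blast
  qed
  ultimately have "generate G {\<tau>, \<sigma>} \<subseteq> range elt"
    by (intro generate_subgroup_incl)
  then show ?thesis using generated elt_closed by blast
qed

text \<open>Injectivity comes from counting: a set of \<open>2 * n\<close> pairs is mapped onto a
  group of order \<open>2 * n\<close>.\<close>

lemma bij_betw_elt:
  assumes "n > 0"
  shows "bij_betw elt ({0..<int n} \<times> UNIV) (carrier G)"
proof -
  let ?V = "{0..<int n} \<times> (UNIV :: bool set)"
  have im: "elt ` ?V = carrier G"
  proof
    show "elt ` ?V \<subseteq> carrier G" using elt_closed by blast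
    show "carrier G \<subseteq> elt ` ?V"
    proof
      fix a assume "a \<in> carrier G"
      then obtain i s where "a = elt (i, s)" using range_elt by (metis imageE surj_pair)
      then have "a = elt (i mod int n, s)" by (simp add: elt_mod)
      then show "a \<in> elt ` ?V" using assms by auto
    qed
  qed
  moreover have "card ?V = card (carrier G)"
    using order_eq by (simp add: card_cartesian_product order_def)
  then have "inj_on elt ?V"
    using im by (intro eq_card_imp_inj_on) auto
  ultimately show ?thesis by (simp add: bij_betw_def)
qed

end

section \<open>Transfer of the count to the dihedral group\<close>

locale dihedral_group_odd_prime = dihedral_group G p \<tau> \<sigma> + odd_prime p for G (structure) and p \<tau> \<sigma>
begin

lemma elt_image_mem_iff:
  assumes "S \<subseteq> V" "x \<in> V" "y \<in> V"
  shows "elt y \<otimes> inv (elt x) \<in> elt ` S \<longleftrightarrow> adj S x y"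
proof -
  let ?q = "\<lambda>k. (k, snd x \<noteq> snd y)"
  let ?k = "if snd x then fst x - fst y else fst y - fst x"
  have "elt y \<otimes> inv (elt x) = elt (?q (?k mod P))"
    by (simp only: elt_quotient elt_mod)
  moreover have "?q (?k mod P) \<in> V" by simp
  moreover have "inj_on elt V" using bij_betw_elt P_pos by (simp add: bij_betw_def)
  ultimately show ?thesis
    using inj_on_image_mem_iff[of elt V "?q (?k mod P)" S] assms by (simp only: adj_def)
qed

text \<open>Vertex bijections are conjugated by \<open>elt\<close>; in coordinates they are extended
  by the identity outside \<open>V\<close>.\<close>

lemma digraph_iso_Cay_elt_iff:
  assumes S: "S \<subseteq> V" "T \<subseteq> V"
  shows "digraph_iso (Cay G (elt ` S)) (Cay G (elt ` T)) \<longleftrightarrow> isos S T \<noteq> {}"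
  unfolding digraph_iso_Cay_iff
proof
  have bij: "bij_betw elt V (carrier G)" using bij_betw_elt P_pos by simp
  let ?e = "the_inv_into V elt"
  have inv_bij: "bij_betw ?e (carrier G) V" using bij_betw_the_inv_into[OF bij] .
  have inj: "inj_on elt V" using bij by (rule bij_betw_imp_inj_on)
  have e1: "?e (elt x) = x" if "x \<in> V" for x using the_inv_into_f_f[OF inj that] .
  have e2: "elt (?e g) = g" if "g \<in> carrier G" for g
    using f_the_inv_into_f_bij_betw[OF bij that] .
  {
    assume "\<exists>f. bij_betw f (carrier G) (carrier G) \<and> (\<forall>x\<in>carrier G. \<forall>y\<in>carrier G.
        y \<otimes> inv x \<in> elt ` S \<longleftrightarrow> f y \<otimes> inv f x \<in> elt ` T)"
    then obtain f where f: "bij_betw f (carrier G) (carrier G)"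
      and iff: "\<And>x y. x \<in> carrier G \<Longrightarrow> y \<in> carrier G \<Longrightarrow> y \<otimes> inv x \<in> elt ` S \<longleftrightarrow> f y \<otimes> inv f x \<in> elt ` T"
      by blast
    define g where "g x = (if x \<in> V then ?e (f (elt x)) else x)" for x
    have gV: "elt (g x) = f (elt x)" "g x \<in> V" if "x \<in> V" for x
    proof -
      have "f (elt x) \<in> carrier G" using bij_betw_apply[OF f elt_closed] .
      then show "elt (g x) = f (elt x)" "g x \<in> V"
        using that e2 bij_betw_apply[OF inv_bij] unfolding g_def by simp_all
    qed
    have "bij_betw (?e \<circ> f \<circ> elt) V V"
      using bij_betw_trans[OF bij_betw_trans[OF bij f] inv_bij] by (simp add: comp_assoc)
    then have "bij_betw g V V"
      by (rule bij_betw_cong[THEN iffD1, rotated]) (simp add: g_def)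
    then have "g permutes V" by (rule bij_imp_permutes) (simp add: g_def)
    moreover have "adj S x y \<longleftrightarrow> adj T (g x) (g y)" if xy: "x \<in> V" "y \<in> V" for x y
    proof -
      have "adj S x y \<longleftrightarrow> elt y \<otimes> inv (elt x) \<in> elt ` S"
        using elt_image_mem_iff[OF S(1) xy] by simp
      also have "\<dots> \<longleftrightarrow> elt (g y) \<otimes> inv (elt (g x)) \<in> elt ` T"
        using iff[OF elt_closed elt_closed] gV xy by simp
      also have "\<dots> \<longleftrightarrow> adj T (g x) (g y)"
        by (rule elt_image_mem_iff[OF S(2) gV(2)[OF xy(1)] gV(2)[OF xy(2)]])
      finally show ?thesis .
    qed
    ultimately show "isos S T \<noteq> {}" unfolding rel_isos_def by blast
  next
    assume "isos S T \<noteq> {}"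
    then obtain g where g: "g permutes V" and iff: "\<And>x y. x \<in> V \<Longrightarrow> y \<in> V \<Longrightarrow> adj S x y \<longleftrightarrow> adj T (g x) (g y)"
      unfolding rel_isos_def by blast
    define f where "f = elt \<circ> g \<circ> ?e"
    have "bij_betw f (carrier G) (carrier G)"
      unfolding f_def using bij_betw_trans[OF inv_bij bij_betw_trans[OF permutes_imp_bij[OF g] bij]]
      by (simp add: comp_assoc)
    moreover have "y \<otimes> inv x \<in> elt ` S \<longleftrightarrow> f y \<otimes> inv f x \<in> elt ` T"
      if xy: "x \<in> carrier G" "y \<in> carrier G" for x y
    proof -
      have eV: "?e x \<in> V" "?e y \<in> V" using xy bij_betw_apply[OF inv_bij] by blast+
      have gV: "g (?e x) \<in> V" "g (?e y) \<in> V" 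
        using eV by (simp_all only: permutes_in_image[OF g])
      have "y \<otimes> inv x \<in> elt ` S \<longleftrightarrow> adj S (?e x) (?e y)"
        using elt_image_mem_iff[OF S(1) eV] e2 xy by simp
      also have "\<dots> \<longleftrightarrow> adj T (g (?e x)) (g (?e y))" using iff[OF eV] .
      also have "\<dots> \<longleftrightarrow> f y \<otimes> inv f x \<in> elt ` T"
        using elt_image_mem_iff[OF S(2) gV] by (simp add: f_def)
      finally show ?thesis .
    qed
    ultimately show "\<exists>f. bij_betw f (carrier G) (carrier G) \<and> (\<forall>x\<in>carrier G. \<forall>y\<in>carrier G.
        y \<otimes> inv x \<in> elt ` S \<longleftrightarrow> f y \<otimes> inv f x \<in> elt ` T)"
      by blast
  }
qed

lemma card_iso_classes:
  "card (iso_classes (cayley_digraphs G))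
    = card (Pow W // {(S, T). S \<in> Pow W \<and> T \<in> Pow W \<and> isos S T \<noteq> {}})"
proof -
  have bij: "bij_betw elt V (carrier G)" using bij_betw_elt P_pos by simp
  have inj: "inj_on elt V" using bij by (rule bij_betw_imp_inj_on)
  have "elt ` W = elt ` V - elt ` {(0, False)}"
    using inj P_pos by (intro inj_on_image_set_diff) auto
  also have "\<dots> = carrier G - {\<one>}"
    using bij by (simp add: bij_betw_def elt_def)
  finally have W: "elt ` W = carrier G - {\<one>}" .
  have "bij_betw (\<lambda>S. Cay G (elt ` S)) (Pow W) (cayley_digraphs G)"
    unfolding bij_betw_def
  proof
    have "inj_on ((`) elt) (Pow W)"
      using inj by (intro inj_on_image_Pow inj_on_subset[OF inj]) auto
    moreover have "inj_on (Cay G) ((`) elt ` Pow W)"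
      using inj_on_Cay by (rule inj_on_subset) (use elt_closed in blast)
    ultimately have "inj_on (Cay G \<circ> (`) elt) (Pow W)" by (rule comp_inj_on)
    then show "inj_on (\<lambda>S. Cay G (elt ` S)) (Pow W)" by (simp add: comp_def)
    have "(\<lambda>S. Cay G (elt ` S)) ` Pow W = Cay G ` Pow (elt ` W)"
      by (simp only: image_Pow_surj[OF refl, symmetric] image_image)
    also have "\<dots> = cayley_digraphs G" unfolding W cayley_digraphs_def by blast
    finally show "(\<lambda>S. Cay G (elt ` S)) ` Pow W = cayley_digraphs G" .
  qed
  then have "card (Pow W // {(S, T). S \<in> Pow W \<and> T \<in> Pow W \<and> isos S T \<noteq> {}})
      = card (cayley_digraphs G // {(X, Y). X \<in> cayley_digraphs G \<and> Y \<in> cayley_digraphs G \<and> digraph_iso X Y})"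
  proof (rule card_quotient_bij_betw)
    fix S T assume ST: "S \<in> Pow W" "T \<in> Pow W"
    then have "Cay G (elt ` S) \<in> cayley_digraphs G" "Cay G (elt ` T) \<in> cayley_digraphs G"
      unfolding cayley_digraphs_def using W by blast+
    moreover have "S \<subseteq> V" "T \<subseteq> V" using ST by auto
    ultimately show "(S, T) \<in> {(S, T). S \<in> Pow W \<and> T \<in> Pow W \<and> isos S T \<noteq> {}} \<longleftrightarrow>
        (Cay G (elt ` S), Cay G (elt ` T))
          \<in> {(X, Y). X \<in> cayley_digraphs G \<and> Y \<in> cayley_digraphs G \<and> digraph_iso X Y}"
      using ST digraph_iso_Cay_elt_iff by blast
  qed blast+
  then show ?thesis by (simp add: iso_classes_def)
qed

end

theorem theorem3p3:
  fixes G :: "('a, 'm) monoid_scheme" and p :: nat and \<tau> \<sigma> :: 'a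
  assumes "prime p" and "odd p"
    and "dihedral_group G p \<tau> \<sigma>"
  shows "real (card (iso_classes (cayley_digraphs G))) =
    1 / real p * 2 ^ p * (1 - 2 ^ (p - 1)) +
    2 / (real p - 1) * (\<Sum>d | d dvd p - 1. real (totient d) * 2 ^ (2 * (p - 1) div d))"
proof -
  interpret dihedral_group_odd_prime G p \<tau> \<sigma>
    using assms by (simp add: dihedral_group_odd_prime_def odd_prime_def)
  define N where "N = card (iso_classes (cayley_digraphs G))"
  define D where "D = (\<Sum>d | d dvd p - 1. totient d * 2 ^ (2 * (p - 1) div d))"
  have p: "real p > 2" "real (p - 1) = real p - 1" using p_gt_2 by auto
  have "p * (p - 1) * N + 2 * p * 2 ^ (2 * (p - 1)) = 2 * p * D + 2 ^ (p - 1) * (2 ^ p + 2 * (p - 1))"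
    unfolding N_def D_def card_iso_classes by (rule card_orbits)
  then have "real (p * (p - 1) * N + 2 * p * 2 ^ (2 * (p - 1)))
      = real (2 * p * D + 2 ^ (p - 1) * (2 ^ p + 2 * (p - 1)))"
    by (rule arg_cong)
  then have eq: "real p * (real p - 1) * real N + 2 * real p * 2 ^ (2 * (p - 1))
      = 2 * real p * real D + 2 ^ (p - 1) * (2 ^ p + 2 * (real p - 1))"
    by (simp only: of_nat_add of_nat_mult of_nat_power of_nat_numeral p(2))
  \<comment> \<open>In terms of \<open>y\<close> the orbit count is a polynomial identity, and the
    claim follows after multiplication by the nonzero factor \<open>p * (p - 1)\<close>.\<close>
  define y :: real where "y = 2 ^ (p - 1)"
  have y: "2 ^ p = 2 * y" "2 ^ (2 * (p - 1)) = y ^ 2"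
    using p_gt_2 by (simp_all add: y_def power_even_eq flip: power_Suc)
  have "real N = 1 / real p * (2 * y) * (1 - y) + 2 / (real p - 1) * real D"
  proof -
    have "real p * (real p - 1) * (1 / real p * (2 * y) * (1 - y)) = (real p - 1) * (2 * y) * (1 - y)"
      "real p * (real p - 1) * (2 / (real p - 1) * real D) = 2 * real p * real D"
      using p(1) by simp_all
    then have "real p * (real p - 1) * (1 / real p * (2 * y) * (1 - y) + 2 / (real p - 1) * real D)
        = (real p - 1) * (2 * y) * (1 - y) + 2 * real p * real D"
      by (simp only: distrib_left)
    also have "\<dots> = real p * (real p - 1) * real N"
      using eq unfolding y y_def[symmetric] by (simp add: algebra_simps power2_eq_square)
    finally show ?thesis using p(1) by simp
  qed
  moreover have "real D = (\<Sum>d | d dvd p - 1. real (totient d) * 2 ^ (2 * (p - 1) div d))"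
    by (simp add: D_def)
  ultimately show ?thesis
    unfolding N_def[symmetric] y y_def[symmetric] by simp
qed

end
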